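(* Let $D$ be a bounded convex open subset of $\mathbb R^N$ containing the origin. Every horofunction of the Hilbert geometry on $D$ is a Busemann point if and only if the set of extreme sets of the polar $D^\circ$ of $D$ is closed in the Painlevé–Kuratowski topology.
   Context: Hilbert distance on $D$: for distinct $x,y\in D$, let $w,z\in\partial D$ be such that $w,x,y,z$ are collinear in this order; then $d_H(x,y):=\log\frac{|zx|\,|wy|}{|zy|\,|wx|}$, and $d_H(x,x)=0$. Fix a basepoint $b\in D$. A sequence $(x_n)$ in $D$ converges to $g:D\to\mathbb R$ if $d_H(\cdot,x_n)-d_H(b,x_n)\to g$ pointwise; a horofunction is such a limit not of the form $d_H(\cdot,p)-d_H(b,p)$, $p\in D$. An almost-geodesic is a sequence $(x_l)_{l\in\mathbb N}$ in $D$ such that for some $\epsilon>0$, $\sum_{i=1}^l d_H(x_{i-1},x_i)\le d_H(x_0,x_l)+\epsilon$ for all $l\ge 1$; a Busemann point is a horofunction that is the limit of an almost-geodesic. The polar is $D^\circ=\{y\in\mathbb R^N:\langle y,x\rangle\le1\ \forall x\in D\}$. A convex subset $E$ of a convex set $K$ is an extreme set if whenever a relative interior point of a line segment in $K$ lies in $E$, both endpoints lie in $E$. Painlevé–Kuratowski convergence of closed sets: $C_n\to C$ iff (i) every $x\in C$ is the limit of some $x_n\in C_n$ ($n$ large), and (ii) whenever $x_k\in C_{n_k}$ for a subsequence and $x_k\to x$, then $x\in C$. A family of closed sets is closed if it contains all Painlevé–Kuratowski limits of sequences from it. *)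

theory Defs
  imports "HOL-Analysis.Analysis"
begin

definition hilbert_dist :: "'a::euclidean_space set \<Rightarrow> 'a \<Rightarrow> 'a \<Rightarrow> real" where
  "hilbert_dist D x y =
     (if x = y then 0
      else (let w = (THE w. w \<in> frontier D \<and> x \<in> open_segment w y);
                z = (THE z. z \<in> frontier D \<and> y \<in> open_segment x z)
            in ln ((dist z x * dist w y) / (dist z y * dist w x))))"

definition hconverges :: "'a::euclidean_space set \<Rightarrow> 'a \<Rightarrow> (nat \<Rightarrow> 'a) \<Rightarrow> ('a \<Rightarrow> real) \<Rightarrow> bool" where
  "hconverges D b xs g \<longleftrightarrow> (\<forall>n. xs n \<in> D) \<and>
     (\<forall>y\<in>D. (\<lambda>n. hilbert_dist D y (xs n) - hilbert_dist D b (xs n)) \<longlonglongrightarrow> g y)"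

definition horofunction :: "'a::euclidean_space set \<Rightarrow> 'a \<Rightarrow> ('a \<Rightarrow> real) \<Rightarrow> bool" where
  "horofunction D b g \<longleftrightarrow> (\<exists>xs. hconverges D b xs g) \<and>
     \<not> (\<exists>p\<in>D. \<forall>y\<in>D. g y = hilbert_dist D y p - hilbert_dist D b p)"

definition almost_geodesic :: "'a::euclidean_space set \<Rightarrow> (nat \<Rightarrow> 'a) \<Rightarrow> bool" where
  "almost_geodesic D xs \<longleftrightarrow> (\<forall>n. xs n \<in> D) \<and>
     (\<exists>\<epsilon>>0. \<forall>l\<ge>1. (\<Sum>i=1..l. hilbert_dist D (xs (i - 1)) (xs i)) \<le> hilbert_dist D (xs 0) (xs l) + \<epsilon>)"

definition busemann_point :: "'a::euclidean_space set \<Rightarrow> 'a \<Rightarrow> ('a \<Rightarrow> real) \<Rightarrow> bool" where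
  "busemann_point D b g \<longleftrightarrow> horofunction D b g \<and>
     (\<exists>xs. almost_geodesic D xs \<and> hconverges D b xs g)"

definition polar :: "'a::euclidean_space set \<Rightarrow> 'a set" where
  "polar D = {y. \<forall>x\<in>D. inner y x \<le> 1}"

text \<open>Extreme sets of K are exactly the library notion: E face_of K.\<close>

definition PK_converges :: "(nat \<Rightarrow> 'a::euclidean_space set) \<Rightarrow> 'a set \<Rightarrow> bool" where
  "PK_converges Cs C \<longleftrightarrow>
     (\<forall>x\<in>C. \<exists>xs. (\<forall>\<^sub>F n in sequentially. xs n \<in> Cs n) \<and> xs \<longlonglongrightarrow> x) \<and>
     (\<forall>r xs x. strict_mono r \<longrightarrow> (\<forall>k. xs k \<in> Cs (r k)) \<longrightarrow> xs \<longlonglongrightarrow> x \<longrightarrow> x \<in> C)"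

definition PK_closed_family :: "'a::euclidean_space set set \<Rightarrow> bool" where
  "PK_closed_family F \<longleftrightarrow>
     (\<forall>Cs C. (\<forall>n. Cs n \<in> F) \<longrightarrow> closed C \<longrightarrow> PK_converges Cs C \<longrightarrow> C \<in> F)"

end

theory Submission
  imports Defs "HOL-Complex_Analysis.Great_Picard"
begin

text \<open>
  Write \<open>aff y u = 1 - inner u y\<close> on the polar \<open>K\<close> of \<open>D\<close>. The Hilbert distance is
  \<open>ln (funk x y) + ln (funk y x)\<close>, where \<open>funk x y\<close> is the maximum over \<open>K\<close> of \<open>aff x u / aff y u\<close>.
  Hence a horofunction has, up to constants, the form \<open>ln (funk x y) + ln (SUP u. aff y u / f u)\<close>, where \<open>x\<close> is
  a boundary point and \<open>f\<close> is the epigraphical limit of positive multiples of the affine functions given by a sequence converging to \<open>x\<close>.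
  It is a Busemann point if \<open>f\<close> is affine on a face of \<open>K\<close> (and infinite elsewhere): affine functions on \<open>K\<close>
  approximating \<open>f\<close>, with a large multiple of \<open>aff x\<close> added, yield an almost-geodesic.

  If the faces form a closed family, every \<open>f\<close> is of this kind, since the limit of suitable
  faces of \<open>K\<close> is the whole domain of \<open>f\<close>. Conversely, for faces converging to \<open>C\<close> the horofunction
  with \<open>f = 1\<close> on \<open>C\<close> exists, and if it is a Busemann point then the affine functions along an almost-geodesic
  show that \<open>C\<close> is a face.
\<close>

text \<open>Of the two Funk halves of the distance, the one from the moving sequence to
  \<open>y\<close> extends continuously to the boundary point. All difficulty sits in the other
  half, where the rescaled affine functions may tend to infinity on part of the polar. Their limits
  are therefore kept as epigraphs, for which convergent subsequences always exist.

  The obstacle is that the domain of such a limit, though convex, need not be an extreme set. A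
  nonnegative affine function that is bounded at an inner point of a segment is bounded at its ends,
  but the points with bounded values merely converge to \<open>u\<close> and need not lie on
  segments whose ends are near those of a given segment through \<open>u\<close>. Closedness of the
  family of faces supplies exactly these segments.

  In the converse direction the constant 1 is used because it is affine on every face, and because
  its weighted suprema depend only on the set and so pass to the limit. Whether a horofunction is a
  Busemann point is decided by the detour cost \<open>hdist b (p n) + g (p n)\<close>, which tends
  to 0 along an almost-geodesic converging to \<open>g\<close>.\<close>

lemma choose_subseq:
  assumes "\<And>j N. \<exists>n\<ge>N. P j n"
  shows "\<exists>\<rho>::nat \<Rightarrow> nat. strict_mono \<rho> \<and> (\<forall>j. P j (\<rho> j))"
proof -
  have "\<exists>\<rho>. \<forall>j. P j (\<rho> j) \<and> \<rho> j < \<rho> (Suc j)"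
    using assms by (intro dependent_nat_choice) (meson Suc_le_eq)+
  then show ?thesis
    using strict_mono_Suc_iff by blast
qed

subsection \<open>Painleve-Kuratowski limits\<close>

lemma PK_convergesD1:
  assumes "PK_converges Cs C" "x \<in> C"
  obtains xs where "\<forall>\<^sub>F n in sequentially. xs n \<in> Cs n" "xs \<longlonglongrightarrow> x"
  using assms unfolding PK_converges_def by blast

lemma PK_convergesD2:
  assumes "PK_converges Cs C" "strict_mono r" "\<And>k. xs k \<in> Cs (r k)" "xs \<longlonglongrightarrow> x"
  shows "x \<in> C"
  using assms unfolding PK_converges_def by blast

lemma PK_closed_familyD:
  assumes "PK_closed_family \<F>" "\<And>n. Cs n \<in> \<F>" "closed C" "PK_converges Cs C"
  shows "C \<in> \<F>"
  using assms unfolding PK_closed_family_def by blast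

lemma PK_converges_subseq:
  assumes "PK_converges Cs C" "strict_mono r"
  shows "PK_converges (Cs \<circ> r) C"
  unfolding PK_converges_def
proof (intro conjI ballI allI impI)
  fix x assume "x \<in> C"
  then obtain xs where xs: "\<forall>\<^sub>F n in sequentially. xs n \<in> Cs n" "xs \<longlonglongrightarrow> x"
    using assms PK_convergesD1 by blast
  have "\<forall>\<^sub>F n in sequentially. (xs \<circ> r) n \<in> (Cs \<circ> r) n"
    using eventually_subseq[OF assms(2) xs(1)] by simp
  then show "\<exists>xs. (\<forall>\<^sub>F n in sequentially. xs n \<in> (Cs \<circ> r) n) \<and> xs \<longlonglongrightarrow> x"
    using LIMSEQ_subseq_LIMSEQ[OF xs(2) assms(2)] by blast
next
  fix r' xs x assume "strict_mono r'" "\<forall>k. xs k \<in> (Cs \<circ> r) (r' k)" "xs \<longlonglongrightarrow> x"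
  then show "x \<in> C"
    using PK_convergesD2[OF assms(1) strict_mono_o[OF assms(2), of r'], of xs x] by simp
qed

lemma PK_limit_convex:
  assumes "PK_converges Cs C" "\<And>n. convex (Cs n)"
  shows "convex C"
proof (rule convexI)
  fix x y and u v :: real assume *: "x \<in> C" "y \<in> C" "0 \<le> u" "0 \<le> v" "u + v = 1"
  obtain xs where xs: "\<forall>\<^sub>F n in sequentially. xs n \<in> Cs n" "xs \<longlonglongrightarrow> x"
    using assms(1) *(1) by (rule PK_convergesD1)
  obtain ys where ys: "\<forall>\<^sub>F n in sequentially. ys n \<in> Cs n" "ys \<longlonglongrightarrow> y"
    using assms(1) *(2) by (rule PK_convergesD1)
  have "\<forall>\<^sub>F n in sequentially. u *\<^sub>R xs n + v *\<^sub>R ys n \<in> Cs n"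
    using xs(1) ys(1) by eventually_elim (use * assms(2) in \<open>auto intro: convexD\<close>)
  then obtain N where N: "\<And>n. n \<ge> N \<Longrightarrow> u *\<^sub>R xs n + v *\<^sub>R ys n \<in> Cs n"
    by (auto simp: eventually_sequentially)
  have "(\<lambda>n. u *\<^sub>R xs n + v *\<^sub>R ys n) \<longlonglongrightarrow> u *\<^sub>R x + v *\<^sub>R y"
    by (intro tendsto_intros xs ys)
  then have "(\<lambda>n. u *\<^sub>R xs (n + N) + v *\<^sub>R ys (n + N)) \<longlonglongrightarrow> u *\<^sub>R x + v *\<^sub>R y"
    by (rule LIMSEQ_ignore_initial_segment)
  then show "u *\<^sub>R x + v *\<^sub>R y \<in> C"
    by (intro PK_convergesD2[OF assms(1), of "\<lambda>n. n + N"]) (auto simp: strict_mono_def N)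
qed

lemma PK_limit_subset:
  assumes "PK_converges Cs C" "\<And>n. Cs n \<subseteq> K" "closed K"
  shows "C \<subseteq> K"
proof
  fix x assume "x \<in> C"
  then obtain xs where xs: "\<forall>\<^sub>F n in sequentially. xs n \<in> Cs n" "xs \<longlonglongrightarrow> x"
    using assms PK_convergesD1 by blast
  have "\<forall>\<^sub>F n in sequentially. xs n \<in> K"
    using xs(1) by eventually_elim (use assms(2) in auto)
  then show "x \<in> K"
    using xs(2) assms(3) Lim_in_closed_set trivial_limit_sequentially by blast
qed

text \<open>Sequential compactness of the hyperspace. A diagonal argument over a countable basis
  makes every basic open set either eventually hit or eventually missed; the limit consists of the
  points all of whose basic neighbourhoods are eventually hit, and it may be empty.\<close>

theorem PK_convergent_subsequence:
  fixes Cs :: "nat \<Rightarrow> 'a::euclidean_space set"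
  obtains r C where "strict_mono (r :: nat \<Rightarrow> nat)" "closed C" "PK_converges (Cs \<circ> r) C"
proof -
  obtain B :: "'a set set" where B: "countable B" "topological_basis B"
    using ex_countable_basis by blast
  define f :: "nat \<Rightarrow> 'a set \<Rightarrow> real" where "f n U = of_bool (U \<inter> Cs n \<noteq> {})" for n U
  obtain r where r: "strict_mono (r :: nat \<Rightarrow> nat)" "\<And>U. U \<in> B \<Longrightarrow> \<exists>l. (\<lambda>n. f (r n) U) \<longlonglongrightarrow> l"
    using function_convergent_subsequence[OF B(1), of f 1] by (auto simp: f_def)
  define C where "C = {x. \<forall>U\<in>B. x \<in> U \<longrightarrow> (\<lambda>n. f (r n) U) \<longlonglongrightarrow> 1}"
  have "- C = \<Union>{U\<in>B. \<not> (\<lambda>n. f (r n) U) \<longlonglongrightarrow> 1}"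
    by (auto simp: C_def)
  then have closed: "closed C"
    unfolding closed_def using topological_basis_open[OF B(2)] by (simp add: open_Union)
  have "\<exists>xs. (\<forall>\<^sub>F n in sequentially. xs n \<in> (Cs \<circ> r) n) \<and> xs \<longlonglongrightarrow> x" if "x \<in> C" for x
  proof -
    have hit: "\<forall>\<^sub>F n in sequentially. \<exists>y\<in>Cs (r n). dist y x < e" if "e > 0" for e
    proof -
      obtain U where U: "U \<in> B" "x \<in> U" "U \<subseteq> ball x e"
        using topological_basisE[OF B(2) open_ball, of x x e] \<open>e > 0\<close> by auto
      then have "(\<lambda>n. f (r n) U) \<longlonglongrightarrow> 1" using \<open>x \<in> C\<close> by (auto simp: C_def)
      then have "\<forall>\<^sub>F n in sequentially. f (r n) U > 0"
        by (rule order_tendstoD) auto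
      then show ?thesis
        by eventually_elim (use U in \<open>auto simp: f_def dist_commute split: if_splits\<close>)
    qed
    \<comment> \<open>The sets are not assumed closed, so a nearest point is replaced by one within
      \<open>1 / Suc n\<close> of the infimum.\<close>
    define y where "y n = (SOME y. y \<in> Cs (r n) \<and> dist x y < infdist x (Cs (r n)) + 1 / Suc n)" for n
    have y: "y n \<in> Cs (r n) \<and> dist x (y n) < infdist x (Cs (r n)) + 1 / Suc n"
      if "Cs (r n) \<noteq> {}" for n
    proof -
      have "\<exists>z\<in>Cs (r n). dist x z < infdist x (Cs (r n)) + 1 / Suc n"
      proof (rule ccontr)
        assume "\<not> ?thesis"
        then have "infdist x (Cs (r n)) + 1 / Suc n \<le> (INF z\<in>Cs (r n). dist x z)"
          using that by (intro cINF_greatest) (auto simp: not_less)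
        then show False using that by (simp add: infdist_notempty)
      qed
      then show ?thesis
        unfolding y_def Bex_def by (rule someI_ex)
    qed
    have ev: "\<forall>\<^sub>F n in sequentially. y n \<in> (Cs \<circ> r) n"
      using hit[OF zero_less_one] by eventually_elim (use y in auto)
    have "y \<longlonglongrightarrow> x"
    proof (rule tendstoI)
      fix e :: real assume "e > 0"
      have "(\<lambda>n. 1 / real (Suc n)) \<longlonglongrightarrow> 0"
        using LIMSEQ_Suc[OF lim_1_over_n] by simp
      then have "\<forall>\<^sub>F n in sequentially. 1 / real (Suc n) < e / 2"
        by (rule order_tendstoD) (use \<open>e > 0\<close> in simp)
      moreover have "\<forall>\<^sub>F n in sequentially. \<exists>y\<in>Cs (r n). dist y x < e / 2"
        using \<open>e > 0\<close> by (intro hit) simp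
      ultimately show "\<forall>\<^sub>F n in sequentially. dist (y n) x < e"
      proof eventually_elim
        case (elim n)
        then obtain z where z: "z \<in> Cs (r n)" "dist z x < e / 2" by blast
        then have "dist (y n) x < infdist x (Cs (r n)) + 1 / Suc n" "infdist x (Cs (r n)) < e / 2"
          using y[of n] infdist_le[OF z(1), of x] by (auto simp: dist_commute)
        with elim show ?case by simp
      qed
    qed
    then show ?thesis using ev by blast
  qed
  moreover have "x \<in> C" if r': "strict_mono r'" and xs: "\<forall>k. xs k \<in> (Cs \<circ> r) (r' k)" and "xs \<longlonglongrightarrow> x" for r' xs x
  proof -
    have "(\<lambda>n. f (r n) U) \<longlonglongrightarrow> 1" if U: "U \<in> B" "x \<in> U" for U
    proof -
      obtain l where l: "(\<lambda>n. f (r n) U) \<longlonglongrightarrow> l" using r U by blast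
      have "\<forall>\<^sub>F k in sequentially. xs k \<in> U"
        using topological_tendstoD[OF \<open>xs \<longlonglongrightarrow> x\<close> topological_basis_open[OF B(2) U(1)] U(2)] .
      then have "\<forall>\<^sub>F k in sequentially. f (r (r' k)) U = 1"
        by eventually_elim (use xs in \<open>auto simp: f_def\<close>)
      then have "(\<lambda>k. f (r (r' k)) U) \<longlonglongrightarrow> 1"
        by (rule tendsto_eventually)
      then have "l = 1"
        using LIMSEQ_subseq_LIMSEQ[OF l \<open>strict_mono r'\<close>] LIMSEQ_unique by (fastforce simp: o_def)
      then show ?thesis using l by simp
    qed
    then show ?thesis by (auto simp: C_def)
  qed
  ultimately have "PK_converges (Cs \<circ> r) C"
    by (auto simp: PK_converges_def)
  then show ?thesis using that r(1) closed by blast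
qed

subsection \<open>Faces\<close>

lemma face_of_convex_comb:
  assumes "E face_of S" "a \<in> S" "b \<in> S" "0 < t" "t < 1" "(1 - t) *\<^sub>R a + t *\<^sub>R b \<in> E"
  shows "a \<in> E" "b \<in> E"
proof -
  have "a \<in> E \<and> b \<in> E"
  proof (cases "a = b")
    case True
    then show ?thesis using assms(6) by (simp add: scaleR_left_distrib[symmetric])
  next
    case False
    then have "(1 - t) *\<^sub>R a + t *\<^sub>R b \<in> open_segment a b"
      using assms(4,5) unfolding in_segment by blast
    then show ?thesis using assms unfolding face_of_def by blast
  qed
  then show "a \<in> E" "b \<in> E" by blast+
qed

text \<open>On the way from \<open>w\<close> to the outside point \<open>p\<close> one leaves
  \<open>F\<close> through its relative boundary, where a supporting hyperplane cuts off a face of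
  smaller dimension. If \<open>w\<close> is not in the relative interior, \<open>d = 0\<close>
  does.\<close>

lemma exit_through_face:
  fixes F :: "'a::euclidean_space set"
  assumes F: "convex F" "compact F" and w: "w \<in> F" and p: "p \<in> affine hull F" "p \<notin> F"
  obtains d F' where "0 \<le> d" "d \<le> 1" "F' face_of F" "aff_dim F' < aff_dim F" "w + d *\<^sub>R (p - w) \<in> F'"
proof -
  obtain d where d: "0 \<le> d" "d \<le> 1" "w + d *\<^sub>R (p - w) \<in> F" "w + d *\<^sub>R (p - w) \<notin> rel_interior F"
  proof (cases "w \<in> rel_interior F")
    case False
    then show ?thesis using that[of 0] w by simp
  next
    case True
    have "w + (p - w) \<in> affine hull F" "p - w \<noteq> 0" using p w by auto
    then obtain d where d: "0 < d" "w + d *\<^sub>R (p - w) \<in> rel_frontier F"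
        "\<And>e. 0 \<le> e \<Longrightarrow> e < d \<Longrightarrow> w + e *\<^sub>R (p - w) \<in> rel_interior F"
      using ray_to_rel_frontier[OF compact_imp_bounded[OF F(2)] True] by metis
    have "d \<le> 1"
    proof (rule ccontr)
      assume "\<not> d \<le> 1"
      then show False using d(3)[of 1] p(2) rel_interior_subset[of F] by auto
    qed
    with d show ?thesis
      using that[of d] compact_imp_closed[OF F(2)] by (auto simp: rel_frontier_def)
  qed
  obtain a where a: "\<And>y. y \<in> F \<Longrightarrow> a \<bullet> (w + d *\<^sub>R (p - w)) \<le> a \<bullet> y"
      "\<And>y. y \<in> rel_interior F \<Longrightarrow> a \<bullet> (w + d *\<^sub>R (p - w)) < a \<bullet> y"
    using supporting_hyperplane_rel_boundary[OF F(1) d(3,4)] by metis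
  define F' where "F' = F \<inter> {y. a \<bullet> y = a \<bullet> (w + d *\<^sub>R (p - w))}"
  have face: "F' face_of F"
    unfolding F'_def by (rule face_of_Int_supporting_hyperplane_ge) (use F a in auto)
  have "rel_interior F \<noteq> {}" using F(1) w rel_interior_eq_empty by blast
  then have "F' \<noteq> F" using a(2) rel_interior_subset by (force simp: F'_def)
  then show ?thesis
    using that[of d F'] d face face_of_aff_dim_lt[OF F(1) face] by (auto simp: F'_def)
qed

text \<open>The point \<open>y\<close> seen as an affine function with value 1 at the origin. Every
  affine function positive on the polar is a positive multiple of such a function with
  \<open>y\<close> in the domain, so separating functionals can be turned back into points.\<close>

definition aff :: "'a::real_inner \<Rightarrow> 'a \<Rightarrow> real" where
  "aff y u = 1 - inner u y"

lemma aff_0 [simp]: "aff 0 u = 1" "aff y 0 = 1"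
  by (simp_all add: aff_def)

lemma aff_convex_comb:
  "aff y ((1 - t) *\<^sub>R u + t *\<^sub>R v) = (1 - t) * aff y u + t * aff y v"
  by (simp add: aff_def inner_add_left algebra_simps)

lemma aff_convex_comb_left:
  "aff ((1 - t) *\<^sub>R x + t *\<^sub>R y) u = (1 - t) * aff x u + t * aff y u"
  by (simp add: aff_def inner_add_right algebra_simps)

lemma abs_aff_diff_le: "\<bar>aff x u - aff y u\<bar> \<le> norm u * dist x y"
  using Cauchy_Schwarz_ineq2[of u "y - x"]
  by (simp add: aff_def inner_diff_right dist_norm norm_minus_commute)

lemma tendsto_aff [tendsto_intros]:
  "(f \<longlongrightarrow> x) F \<Longrightarrow> (g \<longlongrightarrow> u) F \<Longrightarrow> ((\<lambda>n. aff (f n) (g n)) \<longlongrightarrow> aff x u) F"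
  unfolding aff_def by (intro tendsto_intros)

lemma continuous_on_aff [continuous_intros]:
  "continuous_on S f \<Longrightarrow> continuous_on S g \<Longrightarrow> continuous_on S (\<lambda>n. aff (f n) (g n))"
  unfolding aff_def by (intro continuous_intros)

text \<open>The weight is a set of pairs and not a function because it arises as a limit of
  epigraphs whose domain is not known beforehand. Where \<open>aff y\<close> is positive, raising
  the second component lowers the quotient, so a graph and its epigraph give the same
  supremum.\<close>

definition wsup :: "('a::real_inner \<times> real) set \<Rightarrow> 'a \<Rightarrow> real" where
  "wsup S y = (SUP p\<in>S. aff y (fst p) / snd p)"

section \<open>The domain and its polar: duality, compactness and bounds\<close>

locale hilbert_domain =
  fixes D :: "'a::euclidean_space set"
  assumes bounded_D: "bounded D" and convex_D: "convex D" and open_D: "open D" and zero_D: "0 \<in> D"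
begin

abbreviation "K \<equiv> polar D"

text \<open>Openness gives strictness: \<open>x\<close> can be stretched by a factor
  \<open>1 + d\<close> inside \<open>D\<close>, whence
  \<open>inner u x \<le> 1 / (1 + d)\<close>.\<close>

lemma aff_pos: "x \<in> D \<Longrightarrow> u \<in> K \<Longrightarrow> 0 < aff x u"
proof -
  assume x: "x \<in> D" and u: "u \<in> K"
  obtain e where e: "e > 0" "cball x e \<subseteq> D" using open_D x open_contains_cball by blast
  define d where "d = e / (norm x + 1)"
  have n: "0 < norm x + 1" by (simp add: add_nonneg_pos)
  with e(1) have d: "d > 0" by (simp add: d_def)
  have "norm x \<le> norm x + 1" by simp
  then have "d * norm x \<le> e"
    using e(1) n by (simp add: d_def divide_simps mult_left_mono)
  then have "x + d *\<^sub>R x \<in> cball x e"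
    using d by (simp add: dist_norm)
  then have "inner u (x + d *\<^sub>R x) \<le> 1" using e u by (auto simp: polar_def)
  then have "(1 + d) * inner u x \<le> 1" by (simp add: algebra_simps)
  then have "inner u x < 1"
  proof (rule contrapos_pp)
    assume "\<not> inner u x < 1"
    then have "(1 + d) * 1 \<le> (1 + d) * inner u x" using d by (intro mult_left_mono) auto
    then show "\<not> (1 + d) * inner u x \<le> 1" using d unfolding mult_1_right by linarith
  qed
  then show "0 < aff x u" by (simp add: aff_def)
qed

text \<open>An open form of the bipolar theorem. A hyperplane separating \<open>x\<close> from
  \<open>D\<close>, rescaled to take the value 1 at \<open>x\<close>, is an element of the polar at
  which \<open>aff x\<close> vanishes; a ball around the origin inside \<open>D\<close> makes the
  rescaling factor positive.\<close>

lemma in_D_iff: "x \<in> D \<longleftrightarrow> (\<forall>u\<in>K. 0 < aff x u)"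
proof (intro iffI)
  assume r: "\<forall>u\<in>K. 0 < aff x u"
  show "x \<in> D"
  proof (rule ccontr)
    assume "x \<notin> D"
    then obtain a c where a: "a \<noteq> 0" "\<forall>y\<in>D. inner a y \<le> c" "inner a x \<ge> c"
      using separating_hyperplane_sets[of D "{x}"] convex_D zero_D by auto
    obtain e where e: "e > 0" "cball 0 e \<subseteq> D" using open_D zero_D open_contains_cball by blast
    have "(e / norm a) *\<^sub>R a \<in> D" using e a(1) by auto
    then have "inner a ((e / norm a) *\<^sub>R a) \<le> c" using a by blast
    moreover have "0 < inner a ((e / norm a) *\<^sub>R a)" using e a(1) by simp
    ultimately have "c > 0" by linarith
    then have pos: "inner a x > 0" using a by linarith
    have "inner ((1 / inner a x) *\<^sub>R a) y \<le> 1" if "y \<in> D" for y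
    proof -
      have "inner a y \<le> inner a x" using a that by force
      with pos show ?thesis by simp
    qed
    then have "(1 / inner a x) *\<^sub>R a \<in> K" by (auto simp: polar_def)
    with r have "0 < aff x ((1 / inner a x) *\<^sub>R a)" by blast
    with pos show False by (simp add: aff_def)
  qed
qed (use aff_pos in blast)

lemma scaleR_in_D:
  assumes "\<forall>u\<in>K. 0 \<le> aff x u" "0 \<le> t" "t < 1"
  shows "t *\<^sub>R x \<in> D"
proof -
  have "0 < aff (t *\<^sub>R x) u" if "u \<in> K" for u
  proof -
    have "t * inner u x \<le> t * 1" using assms that by (intro mult_left_mono) (auto simp: aff_def)
    with assms(3) show ?thesis by (simp add: aff_def)
  qed
  then show ?thesis by (simp add: in_D_iff)
qed

lemma in_closure_iff: "x \<in> closure D \<longleftrightarrow> (\<forall>u\<in>K. 0 \<le> aff x u)"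
proof (intro iffI)
  assume x: "x \<in> closure D"
  have "{x. \<forall>u\<in>K. 0 \<le> aff x u} = (\<Inter>u\<in>K. {x. 0 \<le> aff x u})" by auto
  moreover have "closed {x. 0 \<le> aff x u}" for u :: 'a
    unfolding aff_def by (intro closed_Collect_le continuous_intros)
  ultimately have "closed {x. \<forall>u\<in>K. 0 \<le> aff x u}" by (simp add: closed_INT)
  moreover have "D \<subseteq> {x. \<forall>u\<in>K. 0 \<le> aff x u}" using aff_pos less_imp_le by blast
  ultimately show "\<forall>u\<in>K. 0 \<le> aff x u" using x closure_minimal by blast
next
  assume r: "\<forall>u\<in>K. 0 \<le> aff x u"
  have "(\<lambda>n. 1 - 1 / real (Suc n)) \<longlonglongrightarrow> 1 - 0"
    using LIMSEQ_Suc[OF lim_1_over_n] by (intro tendsto_intros) simp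
  then have "(\<lambda>n. (1 - 1 / real (Suc n)) *\<^sub>R x) \<longlonglongrightarrow> 1 *\<^sub>R x"
    by (intro tendsto_intros) simp
  moreover have "(1 - 1 / real (Suc n)) *\<^sub>R x \<in> D" for n
    using r by (intro scaleR_in_D) auto
  ultimately show "x \<in> closure D"
    unfolding closure_sequential by (intro exI[of _ "\<lambda>n. (1 - 1 / real (Suc n)) *\<^sub>R x"]) simp
qed

lemma in_frontier_iff: "x \<in> frontier D \<longleftrightarrow> (\<forall>u\<in>K. 0 \<le> aff x u) \<and> (\<exists>u\<in>K. aff x u = 0)"
proof -
  have "x \<in> frontier D \<longleftrightarrow> (\<forall>u\<in>K. 0 \<le> aff x u) \<and> \<not> (\<forall>u\<in>K. 0 < aff x u)"
    unfolding frontier_def interior_open[OF open_D] Diff_iff in_closure_iff in_D_iff[of x] ..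
  then show ?thesis
    by (metis less_irrefl order.not_eq_order_implies_strict)
qed

lemma frontier_zeroE:
  assumes "x \<in> frontier D"
  obtains u where "u \<in> K" "aff x u = 0"
  using assms in_frontier_iff by blast

lemma zero_K [simp]: "0 \<in> K" by (simp add: polar_def)

lemma K_nonempty: "K \<noteq> {}" using zero_K by (metis emptyE)

lemma closed_K: "closed K"
proof -
  have "K = (\<Inter>x\<in>D. {u. inner u x \<le> 1})" by (auto simp: polar_def)
  then show ?thesis by (simp add: closed_INT closed_Collect_le continuous_on_inner)
qed

lemma convex_K: "convex K"
proof -
  have "K = (\<Inter>x\<in>D. {u. inner x u \<le> 1})" by (auto simp: polar_def inner_commute)
  then show ?thesis by (simp add: convex_INT convex_halfspace_le)
qed

lemma compact_K: "compact K"
proof -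
  obtain e where e: "e > 0" "cball 0 e \<subseteq> D" using open_D zero_D open_contains_cball by blast
  have "norm u \<le> 1 / e" if u: "u \<in> K" for u
  proof (cases "u = 0")
    case False
    then have "(e / norm u) *\<^sub>R u \<in> D" using e by auto
    then have "inner u ((e / norm u) *\<^sub>R u) \<le> 1" using u by (auto simp: polar_def)
    then have "e * norm u \<le> 1" using False by (simp add: power2_norm_eq_inner[symmetric] power2_eq_square)
    then show ?thesis using e by (simp add: field_simps)
  qed (use e in simp)
  then have "bounded K" by (auto simp: bounded_iff)
  then show ?thesis using closed_K compact_eq_bounded_closed by blast
qed

lemma zero_interior_K: "0 \<in> interior K"
proof -
  obtain M where M: "M > 0" "\<And>x. x \<in> D \<Longrightarrow> norm x \<le> M" using bounded_D bounded_pos by metis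
  have "ball 0 (1 / M) \<subseteq> K"
  proof
    fix u :: 'a assume "u \<in> ball 0 (1 / M)"
    then have u: "norm u \<le> 1 / M" by simp
    have "inner u x \<le> 1" if "x \<in> D" for x
    proof -
      have "inner u x \<le> norm u * norm x" by (rule norm_cauchy_schwarz)
      also have "\<dots> \<le> 1 / M * M" using u M that by (intro mult_mono) auto
      finally show ?thesis using M by simp
    qed
    then show "u \<in> K" by (simp add: polar_def)
  qed
  then show ?thesis using M(1) by (meson centre_in_ball interior_maximal open_ball subsetD zero_less_divide_1_iff)
qed

definition radius :: real where "radius = (SOME B. 0 < B \<and> (\<forall>u\<in>K. norm u \<le> B))"

lemma radius: "0 < radius" "u \<in> K \<Longrightarrow> norm u \<le> radius"
proof -
  have "\<exists>B. 0 < B \<and> (\<forall>u\<in>K. norm u \<le> B)"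
    using compact_imp_bounded[OF compact_K] bounded_pos by auto
  then have "0 < radius \<and> (\<forall>u\<in>K. norm u \<le> radius)"
    unfolding radius_def by (rule someI_ex)
  then show "0 < radius" "u \<in> K \<Longrightarrow> norm u \<le> radius" by auto
qed

lemma abs_aff_diff_le_radius: "u \<in> K \<Longrightarrow> \<bar>aff x u - aff y u\<bar> \<le> radius * dist x y"
  by (rule order_trans[OF abs_aff_diff_le]) (use radius in \<open>auto intro: mult_right_mono\<close>)

lemma aff_lower_bound:
  assumes "y \<in> D"
  obtains c where "0 < c" "\<And>u. u \<in> K \<Longrightarrow> c \<le> aff y u"
proof -
  have "continuous_on K (aff y)" by (intro continuous_intros)
  from continuous_attains_inf[OF compact_K K_nonempty this]
  obtain u where "u \<in> K" "\<forall>v\<in>K. aff y u \<le> aff y v" by (elim bexE)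
  then show ?thesis using that aff_pos assms by blast
qed

lemma abs_aff_le: "u \<in> K \<Longrightarrow> \<bar>aff y u\<bar> \<le> 1 + radius * norm y"
  using abs_aff_diff_le_radius[of u y 0] by (simp add: dist_norm)

subsection \<open>Weighted suprema\<close>

text \<open>The common positive bound \<open>c\<close> from below keeps the quotients in
  \<open>wsup\<close> bounded and makes \<open>wsup S\<close> Lipschitz with constant
  \<open>radius / c\<close>.\<close>

definition weights :: "('a \<times> real) set \<Rightarrow> real \<Rightarrow> bool" where
  "weights S c \<longleftrightarrow> S \<noteq> {} \<and> 0 < c \<and> S \<subseteq> K \<times> {c..}"

lemma weightsD:
  assumes "weights S c"
  shows "S \<noteq> {}" "0 < c" "(u, s) \<in> S \<Longrightarrow> u \<in> K" "(u, s) \<in> S \<Longrightarrow> c \<le> s" "(u, s) \<in> S \<Longrightarrow> 0 < s"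
proof -
  show "S \<noteq> {}" "0 < c" using assms by (auto simp: weights_def)
  show "u \<in> K" "c \<le> s" if "(u, s) \<in> S" using assms that by (auto simp: weights_def)
  then show "0 < s" if "(u, s) \<in> S" using that \<open>0 < c\<close> by force
qed

lemma wsup_upper:
  assumes "weights S c" "(u, s) \<in> S"
  shows "aff y u \<le> wsup S y * s"
proof -
  have "aff y v / r \<le> (1 + radius * norm y) / c" if "(v, r) \<in> S" for v r
  proof -
    have "aff y v \<le> 1 + radius * norm y" using abs_aff_le[of v y] weightsD(3)[OF assms(1) that] by simp
    moreover have "0 \<le> 1 + radius * norm y" using radius(1) by simp
    ultimately show ?thesis using weightsD(2,4,5)[OF assms(1)] that by (intro frac_le) auto
  qed
  then have "bdd_above ((\<lambda>p. aff y (fst p) / snd p) ` S)" by (intro bdd_aboveI2[where M = "(1 + radius * norm y) / c"]) auto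
  then have "aff y u / s \<le> wsup S y"
    unfolding wsup_def using cSUP_upper[OF assms(2), of "\<lambda>p. aff y (fst p) / snd p"] by simp
  then show ?thesis using weightsD(5)[OF assms] by (simp add: field_simps)
qed

lemma wsup_least:
  assumes "weights S c" "\<And>u s. (u, s) \<in> S \<Longrightarrow> aff y u \<le> m * s"
  shows "wsup S y \<le> m"
  unfolding wsup_def
proof (rule cSUP_least)
  fix p assume "p \<in> S"
  then show "aff y (fst p) / snd p \<le> m"
    using assms(2)[of "fst p" "snd p"] weightsD(5)[OF assms(1), of "fst p" "snd p"] by (simp add: field_simps)
qed (use weightsD(1)[OF assms(1)] in simp)

lemma wsup_pos:
  assumes "weights S c" "y \<in> D"
  shows "0 < wsup S y"
proof -
  obtain p where "p \<in> S" using weightsD(1)[OF assms(1)] by blast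
  then have p: "(fst p, snd p) \<in> S" by simp
  have "0 < aff y (fst p)" using aff_pos assms(2) weightsD(3)[OF assms(1) p] by blast
  also have "\<dots> \<le> wsup S y * snd p" by (rule wsup_upper[OF assms(1) p])
  finally show ?thesis using weightsD(5)[OF assms(1) p] by (simp add: zero_less_mult_iff)
qed

lemma wsup_diff_le:
  assumes S: "weights S c"
  shows "\<bar>wsup S x - wsup S y\<bar> \<le> radius / c * dist x y"
proof -
  have "wsup S x \<le> wsup S y + radius / c * dist x y" for x y
  proof (rule wsup_least[OF S])
    fix u s assume us: "(u, s) \<in> S"
    have "aff x u \<le> aff y u + radius * dist x y"
      using abs_aff_diff_le_radius[of u x y] weightsD(3)[OF S us] by linarith
    also have "\<dots> \<le> wsup S y * s + (radius / c * dist x y) * s"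
    proof (rule add_mono)
      have "c \<le> s" "0 < c" using weightsD[OF S] us by auto
      then show "radius * dist x y \<le> (radius / c * dist x y) * s"
        using radius(1) by (simp add: field_simps mult_right_mono)
    qed (rule wsup_upper[OF S us])
    finally show "aff x u \<le> (wsup S y + radius / c * dist x y) * s" by (simp add: algebra_simps)
  qed
  from this[of x y] this[of y x] show ?thesis by (simp add: dist_commute abs_le_iff)
qed

lemma tendsto_wsup:
  assumes "weights S c" "(f \<longlongrightarrow> y) F"
  shows "((\<lambda>n. wsup S (f n)) \<longlongrightarrow> wsup S y) F"
proof (rule LIM_zero_cancel, rule tendsto_0_le)
  show "((\<lambda>n. dist (f n) y) \<longlongrightarrow> 0) F" using assms(2) tendsto_dist_iff by blast
  show "\<forall>\<^sub>F n in F. norm (wsup S (f n) - wsup S y) \<le> norm (dist (f n) y) * (radius / c)"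
    using wsup_diff_le[OF assms(1)] by (intro always_eventually) (simp add: mult.commute)
qed

subsection \<open>The Funk and Hilbert distances\<close>

text \<open>The exponential of the Funk distance. Using the graph of \<open>aff y\<close> as weights
  makes it an instance of \<open>wsup\<close>, so the functions of \<open>x\<close> given by points
  of \<open>D\<close> and those given by limits obey the same estimates.\<close>

definition funk :: "'a \<Rightarrow> 'a \<Rightarrow> real" where
  "funk x y = wsup ((\<lambda>u. (u, aff y u)) ` K) x"

lemma weights_graph:
  assumes "y \<in> D"
  obtains c where "weights ((\<lambda>u. (u, aff y u)) ` K) c"
proof -
  obtain c where "0 < c" "\<And>u. u \<in> K \<Longrightarrow> c \<le> aff y u" using aff_lower_bound[OF assms] by blast
  then have "weights ((\<lambda>u. (u, aff y u)) ` K) c"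
    using zero_K unfolding weights_def by blast
  then show ?thesis by (rule that)
qed

lemma funk_upper: "y \<in> D \<Longrightarrow> u \<in> K \<Longrightarrow> aff x u \<le> funk x y * aff y u"
  unfolding funk_def by (rule weights_graph, assumption, erule wsup_upper) auto

lemma funk_least: "y \<in> D \<Longrightarrow> (\<And>u. u \<in> K \<Longrightarrow> aff x u \<le> m * aff y u) \<Longrightarrow> funk x y \<le> m"
  unfolding funk_def by (rule weights_graph, assumption, erule wsup_least) auto

lemma funk_ge_1: "y \<in> D \<Longrightarrow> 1 \<le> funk x y"
  using funk_upper[of y 0 x] by simp

lemma funk_pos: "y \<in> D \<Longrightarrow> 0 < funk x y"
  using funk_ge_1[of y x] by simp

lemma funk_refl: "y \<in> D \<Longrightarrow> funk y y = 1"
  using funk_ge_1[of y y] funk_least[of y y 1] by simp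

lemma funk_attained:
  assumes "y \<in> D"
  obtains u where "u \<in> K" "aff x u = funk x y * aff y u"
proof -
  have "continuous_on K (\<lambda>u. aff x u / aff y u)"
    using aff_pos[OF assms] by (intro continuous_intros) force
  from continuous_attains_sup[OF compact_K K_nonempty this]
  obtain u where u: "u \<in> K" "\<forall>v\<in>K. aff x v / aff y v \<le> aff x u / aff y u" by (elim bexE)
  have pos: "\<And>v. v \<in> K \<Longrightarrow> 0 < aff y v" using aff_pos[OF assms] .
  have "funk x y \<le> aff x u / aff y u"
  proof (rule funk_least[OF assms])
    fix v assume v: "v \<in> K"
    with u(2) have "aff x v / aff y v \<le> aff x u / aff y u" by blast
    then show "aff x v \<le> aff x u / aff y u * aff y v" unfolding pos_divide_le_eq[OF pos[OF v]] .
  qed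
  then have "funk x y * aff y u \<le> aff x u" unfolding pos_le_divide_eq[OF pos[OF u(1)]] .
  then show ?thesis using that[OF u(1)] funk_upper[OF assms u(1), of x] by simp
qed

lemma funk_triangle:
  assumes "y \<in> D" "z \<in> D"
  shows "funk x z \<le> funk x y * funk y z"
proof (rule funk_least[OF assms(2)])
  fix u assume u: "u \<in> K"
  have "aff x u \<le> funk x y * aff y u" by (rule funk_upper) fact+
  also have "\<dots> \<le> funk x y * (funk y z * aff z u)"
    using funk_upper[OF assms(2) u, of y] funk_pos[OF assms(1), of x] by (intro mult_left_mono) auto
  finally show "aff x u \<le> funk x y * funk y z * aff z u" by (simp add: mult.assoc)
qed

lemma tendsto_funk:
  assumes "y \<in> D" "(f \<longlongrightarrow> x) F"
  shows "((\<lambda>n. funk (f n) y) \<longlongrightarrow> funk x y) F"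
  unfolding funk_def using weights_graph[OF assms(1)] tendsto_wsup assms(2) by metis

text \<open>Since \<open>aff x\<close> is at least \<open>c\<close>, the error
  \<open>radius * dist (xs n) x\<close> in the denominator is relatively small. This serves to
  exclude that a sequence defining a horofunction accumulates inside \<open>D\<close>.\<close>

lemma tendsto_funk_right_1:
  assumes "\<And>n. xs n \<in> D" "xs \<longlonglongrightarrow> x" "x \<in> D"
  shows "(\<lambda>n. funk x (xs n)) \<longlonglongrightarrow> 1"
proof -
  obtain c where c: "0 < c" "\<And>u. u \<in> K \<Longrightarrow> c \<le> aff x u" using aff_lower_bound[OF assms(3)] by blast
  define e where "e n = radius * dist (xs n) x / c" for n
  have "(\<lambda>n. radius * dist (xs n) x / c) \<longlonglongrightarrow> radius * dist x x / c"
    using c(1) by (intro tendsto_intros assms) auto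
  then have e: "e \<longlonglongrightarrow> 0" by (simp add: e_def[abs_def])
  then have "\<forall>\<^sub>F n in sequentially. e n < 1" by (rule order_tendstoD) simp
  then have le: "\<forall>\<^sub>F n in sequentially. funk x (xs n) \<le> 1 / (1 - e n)"
  proof eventually_elim
    case (elim n)
    show ?case
    proof (rule funk_least[OF assms(1)])
      fix u assume u: "u \<in> K"
      have "e n * c \<le> e n * aff x u"
        using c u radius by (intro mult_left_mono) (auto simp: e_def)
      then have "radius * dist (xs n) x \<le> e n * aff x u" using c by (simp add: e_def)
      then have "(1 - e n) * aff x u \<le> aff (xs n) u"
        using abs_aff_diff_le_radius[OF u, of "xs n" x] by (simp add: algebra_simps)
      then show "aff x u \<le> 1 / (1 - e n) * aff (xs n) u"
        using elim by (simp add: field_simps)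
    qed
  qed
  have "(\<lambda>n. 1 / (1 - e n)) \<longlonglongrightarrow> 1 / (1 - 0)"
    by (intro tendsto_intros e) simp
  then have lim: "(\<lambda>n. 1 / (1 - e n)) \<longlonglongrightarrow> 1" by simp
  show ?thesis
    by (rule tendsto_sandwich[OF always_eventually le tendsto_const lim]) (simp add: funk_ge_1[OF assms(1)])
qed

text \<open>With \<open>y\<close> dividing the segment from \<open>x\<close> to \<open>z\<close> at
  parameter \<open>t\<close>, \<open>aff y\<close> is at least \<open>(1 - t) * aff x\<close>, with
  equality where \<open>aff z\<close> vanishes. So the largest ratio of \<open>aff x\<close> to
  \<open>aff y\<close> is \<open>1 / (1 - t)\<close>, which is also the ratio of the distances from
  \<open>z\<close>. As this determines \<open>z\<close> on the ray, uniqueness follows.\<close>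

lemma exit_point:
  assumes "x \<in> D" "y \<in> D" "x \<noteq> y"
  defines "P \<equiv> \<lambda>z. z \<in> frontier D \<and> y \<in> open_segment x z"
  shows "\<exists>!z. P z" "P z \<Longrightarrow> dist z x / dist z y = funk x y"
proof -
  have P_segment: "y \<in> open_segment x z" if "P z" for z using that by (simp add: P_def)
  have ratio: "funk x y = s / (s - 1) \<and> s > 1 \<and> dist z x = s * dist x y \<and> dist z y = (s - 1) * dist x y"
    if Pz: "P z" and z_eq: "z = x + s *\<^sub>R (y - x)" for z s
  proof -
    obtain t where t: "0 < t" "t < 1" "y = (1 - t) *\<^sub>R x + t *\<^sub>R z"
      using P_segment[OF Pz] unfolding in_segment by blast
    have "y - x = t *\<^sub>R (z - x)" using t(3) by (simp add: algebra_simps)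
    also have "\<dots> = (t * s) *\<^sub>R (y - x)" using z_eq by simp
    finally have "(1 - t * s) *\<^sub>R (y - x) = 0" by (simp add: scaleR_diff_left)
    then have "t * s = 1" using assms(3) by simp
    then have ts: "s = 1 / t" using t(1) by (simp add: field_simps)
    then have s: "s > 1" using t(1,2) by simp
    have affy: "aff y u = (1 - t) * aff x u + t * aff z u" for u
      using t(3) aff_convex_comb_left by blast
    have z: "\<forall>u\<in>K. 0 \<le> aff z u" using Pz in_frontier_iff by (auto simp: P_def)
    have st: "s / (s - 1) = 1 / (1 - t)" using ts s t(1,2) by (simp add: field_simps)
    have "funk x y \<le> 1 / (1 - t)"
    proof (rule funk_least[OF assms(2)])
      fix u assume "u \<in> K"
      then have "(1 - t) * aff x u \<le> aff y u" using affy[of u] z t by simp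
      then show "aff x u \<le> 1 / (1 - t) * aff y u" using t(1,2) by (simp add: field_simps)
    qed
    moreover obtain u where u: "u \<in> K" "aff z u = 0" using Pz frontier_zeroE by (auto simp: P_def)
    then have "aff y u = (1 - t) * aff x u" using affy by simp
    then have "aff x u \<le> funk x y * (1 - t) * aff x u" using funk_upper[OF assms(2) u(1), of x] by (simp add: mult.assoc)
    then have "1 \<le> funk x y * (1 - t)" using aff_pos[OF assms(1) u(1)] by simp
    then have "1 / (1 - t) \<le> funk x y" using t(1,2) by (simp add: pos_divide_le_eq)
    ultimately have "funk x y = s / (s - 1)" using st by simp
    moreover have "z - y = (s - 1) *\<^sub>R (y - x)" using z_eq by (simp add: algebra_simps)
    ultimately show ?thesis using s z_eq by (simp add: dist_norm norm_minus_commute)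
  qed
  have form: "\<exists>s. z = x + s *\<^sub>R (y - x)" if Pz: "P z" for z
  proof -
    obtain t where t: "0 < t" "t < 1" "y = (1 - t) *\<^sub>R x + t *\<^sub>R z"
      using P_segment[OF Pz] unfolding in_segment by blast
    have "y - x = t *\<^sub>R (z - x)" using t(3) by (simp add: algebra_simps)
    then have "(1 / t) *\<^sub>R (y - x) = z - x" using t(1) by simp
    then have "z = x + (1 / t) *\<^sub>R (y - x)" by simp
    then show ?thesis by blast
  qed
  show "dist z x / dist z y = funk x y" if "P z"
    using form[OF that] ratio[OF that] assms(3) by auto
  have ex: "\<exists>z. P z"
  proof -
    obtain d where d: "0 < d" "x + d *\<^sub>R (y - x) \<in> frontier D" "\<And>e. 0 \<le> e \<Longrightarrow> e < d \<Longrightarrow> x + e *\<^sub>R (y - x) \<in> interior D"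
      using ray_to_frontier[OF bounded_D, of x "y - x"] assms open_D interior_open by auto
    have "x + 1 *\<^sub>R (y - x) \<in> D" using assms by simp
    then have "d \<noteq> 1" using d(2) open_D by (auto simp: frontier_def interior_open)
    moreover have "\<not> d < 1"
    proof
      assume "d < 1"
      have "(1 - d) *\<^sub>R x + d *\<^sub>R y \<in> D"
        using assms d(1) \<open>d < 1\<close> by (intro convexD[OF convex_D]) auto
      then have "x + d *\<^sub>R (y - x) \<in> D" by (simp add: algebra_simps)
      then show False using d(2) open_D by (auto simp: frontier_def interior_open)
    qed
    ultimately have "d > 1" by simp
    then have "y = (1 - 1 / d) *\<^sub>R x + (1 / d) *\<^sub>R (x + d *\<^sub>R (y - x))"
      by (simp add: algebra_simps)
    then have "y \<in> open_segment x (x + d *\<^sub>R (y - x))"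
      using \<open>d > 1\<close> assms(3) unfolding in_segment
      by (intro conjI exI[of _ "1 / d"]) auto
    then show ?thesis using d(2) by (auto simp: P_def)
  qed
  moreover have "z = z'" if Pz: "P z" "P z'" for z z'
  proof -
    obtain s s' where s: "z = x + s *\<^sub>R (y - x)" "z' = x + s' *\<^sub>R (y - x)"
      using form[OF Pz(1)] form[OF Pz(2)] by blast
    have "s / (s - 1) = s' / (s' - 1)" "s > 1" "s' > 1"
      using ratio[OF Pz(1) s(1)] ratio[OF Pz(2) s(2)] by auto
    then have "s = s'" by (simp add: field_simps)
    with s show ?thesis by simp
  qed
  ultimately show "\<exists>!z. P z" by blast
qed

lemma hilbert_dist_eq:
  assumes "x \<in> D" "y \<in> D"
  shows "hilbert_dist D x y = ln (funk x y) + ln (funk y x)"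
proof (cases "x = y")
  case True
  then show ?thesis using assms by (simp add: hilbert_dist_def funk_refl)
next
  case False
  define z where "z = (THE z. z \<in> frontier D \<and> y \<in> open_segment x z)"
  define w where "w = (THE w. w \<in> frontier D \<and> x \<in> open_segment w y)"
  have z: "dist z x / dist z y = funk x y"
    using exit_point(2)[OF assms False theI'[OF exit_point(1)[OF assms False]]] by (simp add: z_def)
  have "dist w y / dist w x = funk y x"
    using exit_point(2)[OF assms(2,1) _ theI'[OF exit_point(1)[OF assms(2,1)]]] False
    by (simp add: w_def open_segment_commute)
  with z have "dist z x * dist w y / (dist z y * dist w x) = funk x y * funk y x"
    by (metis times_divide_times_eq)
  then show ?thesis
    using False funk_pos[OF assms(1), of y] funk_pos[OF assms(2), of x]
    by (simp add: hilbert_dist_def z_def w_def ln_mult)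
qed

abbreviation "hdist \<equiv> hilbert_dist D"

lemma hdist_commute: "x \<in> D \<Longrightarrow> y \<in> D \<Longrightarrow> hdist x y = hdist y x"
  by (simp add: hilbert_dist_eq)

lemma hdist_nonneg: "x \<in> D \<Longrightarrow> y \<in> D \<Longrightarrow> 0 \<le> hdist x y"
  using funk_ge_1 by (simp add: hilbert_dist_eq)

lemma hdist_triangle:
  assumes "x \<in> D" "y \<in> D" "z \<in> D"
  shows "hdist x z \<le> hdist x y + hdist y z"
proof -
  have "ln (funk x z) \<le> ln (funk x y) + ln (funk y z)"
    using funk_triangle[OF assms(2,3), of x] assms funk_pos
    by (metis ln_mult ln_le_cancel_iff mult_pos_pos less_numeral_extra(3))
  moreover have "ln (funk z x) \<le> ln (funk z y) + ln (funk y x)"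
    using funk_triangle[OF assms(2,1), of z] assms funk_pos
    by (metis ln_mult ln_le_cancel_iff mult_pos_pos less_numeral_extra(3))
  ultimately show ?thesis using assms by (simp add: hilbert_dist_eq)
qed

subsection \<open>Busemann points\<close>

lemma hconverges_lipschitz:
  assumes "hconverges D b xs g" "b \<in> D" "y \<in> D" "z \<in> D"
  shows "g y - g z \<le> hdist y z"
proof -
  have lim: "(\<lambda>n. (hdist y (xs n) - hdist b (xs n)) - (hdist z (xs n) - hdist b (xs n))) \<longlonglongrightarrow> g y - g z"
    using assms(1,3,4) by (intro tendsto_intros) (auto simp: hconverges_def)
  show ?thesis
  proof (rule LIMSEQ_le_const2[OF lim], intro exI allI impI)
    fix n :: nat
    have "xs n \<in> D" using assms(1) by (simp add: hconverges_def)
    then show "(hdist y (xs n) - hdist b (xs n)) - (hdist z (xs n) - hdist b (xs n)) \<le> hdist y z"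
      using hdist_triangle[OF assms(3,4), of "xs n"] by simp
  qed
qed

text \<open>When the detour cost vanishes, \<open>g\<close> drops by almost the full distance along
  sufficiently late steps, so the length of a sparse subsequence telescopes; the Lipschitz bound
  then compares the total drop of \<open>g\<close> with the distance of the ends.\<close>

lemma almost_geodesic_if_no_detour:
  assumes b: "b \<in> D" and conv: "hconverges D b p g"
    and detour: "\<And>\<delta>. 0 < \<delta> \<Longrightarrow> \<forall>\<^sub>F n in sequentially. hdist b (p n) + g (p n) < \<delta>"
  obtains xs where "almost_geodesic D xs" "hconverges D b xs g"
proof -
  have pD: "p n \<in> D" for n using conv by (simp add: hconverges_def)
  \<comment> \<open>Each step loses at most twice \<open>e (Suc j)\<close>, so all losses together
    stay below 2, the constant of the almost-geodesic.\<close>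
  define e :: "nat \<Rightarrow> real" where "e j = (1 / 2) ^ j" for j
  have e: "0 < e j" for j by (simp add: e_def)
  define P where "P j n \<longleftrightarrow> hdist b (p n) + g (p n) < e j" for j n
  define Q where "Q j n n' \<longleftrightarrow> n < n' \<and> hdist (p n) (p n') - hdist b (p n') < g (p n) + e (Suc j)" for j n n'
  have "\<exists>f. \<forall>j. P j (f j) \<and> Q j (f j) (f (Suc j))"
  proof (rule dependent_nat_choice)
    show "\<exists>n. P 0 n"
      using eventually_happens[OF detour[OF e[of 0]]] by (auto simp: P_def)
  next
    fix n j
    have "(\<lambda>n'. hdist (p n) (p n') - hdist b (p n')) \<longlonglongrightarrow> g (p n)"
      using conv pD by (simp add: hconverges_def)
    then have "\<forall>\<^sub>F n' in sequentially. hdist (p n) (p n') - hdist b (p n') < g (p n) + e (Suc j)"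
      by (rule order_tendstoD) (use e[of "Suc j"] in simp)
    then have "\<forall>\<^sub>F n' in sequentially. P (Suc j) n' \<and> Q j n n'"
      using detour[OF e[of "Suc j"]] eventually_gt_at_top[of n]
      by eventually_elim (auto simp: P_def Q_def)
    then show "\<exists>n'. P (Suc j) n' \<and> Q j n n'"
      using eventually_happens by force
  qed
  then obtain f where f: "\<And>j. P j (f j)" "\<And>j. Q j (f j) (f (Suc j))" by blast
  define xs where "xs = p \<circ> f"
  have "strict_mono f" using f(2) by (simp add: strict_mono_Suc_iff Q_def)
  then have conv': "hconverges D b xs g"
    using conv LIMSEQ_subseq_LIMSEQ by (fastforce simp: hconverges_def xs_def o_def)
  have xsD: "xs n \<in> D" for n using pD by (simp add: xs_def)
  have step: "hdist (xs j) (xs (Suc j)) \<le> g (xs j) - g (xs (Suc j)) + 2 * e (Suc j)" for j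
    using f(1)[of "Suc j"] f(2)[of j] by (simp add: P_def Q_def xs_def)
  have "(\<Sum>i=1..l. hdist (xs (i - 1)) (xs i)) \<le> g (xs 0) - g (xs l) + 2 * (1 - e l)" for l
  proof (induction l)
    case (Suc l)
    have "e (Suc l) = e l / 2" by (simp add: e_def)
    then show ?case using Suc step[of l] by simp
  qed (simp add: e_def)
  moreover have "g (xs 0) - g (xs l) \<le> hdist (xs 0) (xs l)" for l
    by (rule hconverges_lipschitz[OF conv b xsD xsD])
  ultimately have "(\<Sum>i=1..l. hdist (xs (i - 1)) (xs i)) \<le> hdist (xs 0) (xs l) + 2" for l
    using e[of l] by (smt (verit, ccfv_SIG))
  then have "almost_geodesic D xs"
    unfolding almost_geodesic_def using xsD by (intro conjI exI[of _ 2]) auto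
  then show ?thesis using that conv' by blast
qed

text \<open>The excess \<sigma> of length over distance from the start is increasing and bounded,
  hence convergent. For \<open>m \<ge> n\<close> the distance between the two points is at most the
  length between them, and letting \<open>m\<close> tend to infinity bounds the detour cost by the
  remaining excess \<open>L - \<sigma> n\<close> plus a null sequence.\<close>

lemma no_detour_if_almost_geodesic:
  assumes b: "b \<in> D" and geo: "almost_geodesic D xs" and conv: "hconverges D b xs g" and \<delta>: "0 < \<delta>"
  shows "\<forall>\<^sub>F n in sequentially. hdist b (xs n) + g (xs n) < \<delta>"
proof -
  have xsD: "xs n \<in> D" for n using conv by (simp add: hconverges_def)
  define len where "len l = (\<Sum>i=1..l. hdist (xs (i - 1)) (xs i))" for l
  define \<sigma> where "\<sigma> l = len l - hdist (xs 0) (xs l)" for l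
  obtain \<epsilon> where eps: "\<And>l. l \<ge> 1 \<Longrightarrow> len l \<le> hdist (xs 0) (xs l) + \<epsilon>"
    using geo unfolding almost_geodesic_def len_def by blast
  have len_Suc: "len (Suc l) = len l + hdist (xs l) (xs (Suc l))" for l by (simp add: len_def)
  have "\<sigma> l \<le> \<sigma> (Suc l)" for l
    using hdist_triangle[OF xsD xsD xsD, of 0 "Suc l" l] len_Suc[of l] by (simp add: \<sigma>_def)
  then have inc: "incseq \<sigma>" by (rule incseq_SucI)
  \<comment> \<open>The defining estimate starts at \<open>l = 1\<close>; monotonicity of \<sigma>
    carries it to \<open>l = 0\<close>.\<close>
  have bound: "\<sigma> l \<le> \<epsilon>" for l
  proof -
    have "\<sigma> l \<le> \<sigma> (Suc l)" using inc by (simp add: incseq_SucD)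
    also have "\<dots> \<le> \<epsilon>" using eps[of "Suc l"] by (simp add: \<sigma>_def)
    finally show ?thesis .
  qed
  obtain L where L: "\<sigma> \<longlonglongrightarrow> L"
    using incseq_convergent[OF inc] bound by blast
  have chain: "hdist (xs n) (xs (n + k)) \<le> len (n + k) - len n" for n k
  proof (induction k)
    case 0
    then show ?case using hilbert_dist_eq[OF xsD xsD, of n n] funk_refl[OF xsD] by simp
  next
    case (Suc k)
    then show ?case
      using hdist_triangle[OF xsD xsD xsD, of n "n + Suc k" "n + k"] len_Suc[of "n + k"] by simp
  qed
  have g0: "(\<lambda>n. hdist (xs 0) (xs n) - hdist b (xs n)) \<longlonglongrightarrow> g (xs 0)"
    using conv xsD by (simp add: hconverges_def)
  have key: "hdist b (xs n) + g (xs n) \<le> (L - \<sigma> n) + (g (xs 0) - (hdist (xs 0) (xs n) - hdist b (xs n)))" for n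
  proof -
    have lim: "(\<lambda>m. hdist (xs n) (xs m) - hdist b (xs m)) \<longlonglongrightarrow> g (xs n)"
      using conv xsD by (simp add: hconverges_def)
    have "\<forall>\<^sub>F m in sequentially. hdist (xs n) (xs m) - hdist b (xs m)
        \<le> (\<sigma> m - \<sigma> n) + ((hdist (xs 0) (xs m) - hdist b (xs m)) - hdist (xs 0) (xs n))"
      using eventually_ge_at_top[of n]
    proof eventually_elim
      case (elim m)
      then obtain k where "m = n + k" using le_Suc_ex by blast
      then show ?case using chain[of n k] by (simp add: \<sigma>_def)
    qed
    moreover have "(\<lambda>m. (\<sigma> m - \<sigma> n) + ((hdist (xs 0) (xs m) - hdist b (xs m)) - hdist (xs 0) (xs n)))
        \<longlonglongrightarrow> (L - \<sigma> n) + (g (xs 0) - hdist (xs 0) (xs n))"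
      by (intro tendsto_intros L g0)
    ultimately have "g (xs n) \<le> (L - \<sigma> n) + (g (xs 0) - hdist (xs 0) (xs n))"
      using tendsto_le[OF trivial_limit_sequentially _ lim] by blast
    then show ?thesis by simp
  qed
  have "(\<lambda>n. (L - \<sigma> n) + (g (xs 0) - (hdist (xs 0) (xs n) - hdist b (xs n)))) \<longlonglongrightarrow> (L - L) + (g (xs 0) - g (xs 0))"
    by (intro tendsto_intros L g0)
  then have "\<forall>\<^sub>F n in sequentially. (L - \<sigma> n) + (g (xs 0) - (hdist (xs 0) (xs n) - hdist b (xs n))) < \<delta>"
    by (rule order_tendstoD) (use \<delta> in simp)
  then show ?thesis
  proof eventually_elim
    case (elim n)
    with key[of n] show ?case by linarith
  qed
qed

subsection \<open>Horofunctions\<close>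

text \<open>
  A set of weights stands for the epigraph of a function on a subset of the polar, and \<open>wsup\<close> for the
  exponential of the corresponding horofunction of the Funk geometry.  A set of weights splits
  when that subset is a face of the polar and the function is affine on it.
\<close>

definition splits :: "('a \<times> real) set \<Rightarrow> bool" where
  "splits S \<longleftrightarrow> (\<forall>u s u1 u2 t. (u, s) \<in> S \<longrightarrow> u1 \<in> K \<longrightarrow> u2 \<in> K \<longrightarrow> 0 < t \<longrightarrow> t < 1 \<longrightarrow>
     u = (1 - t) *\<^sub>R u1 + t *\<^sub>R u2 \<longrightarrow>
     (\<exists>s1 s2. (u1, s1) \<in> S \<and> (u2, s2) \<in> S \<and> (1 - t) * s1 + t * s2 \<le> s))"

lemma splitsD:
  assumes "splits S" "((1 - t) *\<^sub>R u1 + t *\<^sub>R u2, s) \<in> S" "u1 \<in> K" "u2 \<in> K" "0 < t" "t < 1"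
  obtains s1 s2 where "(u1, s1) \<in> S" "(u2, s2) \<in> S" "(1 - t) * s1 + t * s2 \<le> s"
  using assms unfolding splits_def by blast

text \<open>Convexity makes the lower envelope of \<open>S\<close> convex; splitting makes its
  domain extreme in \<open>K\<close> and the envelope concave there. Together they say that it is
  affine on a face, and closure under larger second components makes \<open>S\<close> an
  epigraph.\<close>

definition affine_weights :: "('a \<times> real) set \<Rightarrow> real \<Rightarrow> bool" where
  "affine_weights S c \<longleftrightarrow> weights S c \<and> splits S \<and> closed S \<and> convex S \<and>
     (\<forall>u s s'. (u, s) \<in> S \<longrightarrow> s \<le> s' \<longrightarrow> (u, s') \<in> S)"

lemma affine_weightsD:
  assumes "affine_weights S c"
  shows "weights S c" "splits S" "closed S" "convex S" "(u, s) \<in> S \<Longrightarrow> s \<le> s' \<Longrightarrow> (u, s') \<in> S"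
  using assms unfolding affine_weights_def by blast+

text \<open>The two Funk halves of a horofunction, normalised to vanish at \<open>b\<close>:
  \<open>x\<close> governs the distance from the moving point to \<open>y\<close>, the weights
  \<open>S\<close> govern the distance from \<open>y\<close> to the moving point.\<close>

definition funk_horo :: "'a \<Rightarrow> 'a \<Rightarrow> ('a \<times> real) set \<Rightarrow> 'a \<Rightarrow> real" where
  "funk_horo b x S y = ln (funk x y) - ln (funk x b) + ln (wsup S y) - ln (wsup S b)"

text \<open>All functions \<open>aff y / wsup S y\<close> lie below \<open>S\<close>. A single
  affine function between them and \<open>S\<close>, up to \<epsilon>, is a hyperplane separating
  the compact convex hull of their graphs from the lifted epigraph.\<close>

lemma affine_between:
  assumes aS: "affine_weights S c"
    and Y: "compact Y" "Y \<noteq> {}" "Y \<subseteq> D" and \<epsilon>: "0 < \<epsilon>"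
  shows "\<exists>\<gamma> q. (\<forall>u\<in>K. \<forall>y\<in>Y. aff y u / wsup S y < \<gamma> - inner q u) \<and>
    (\<forall>u s. (u, s) \<in> S \<longrightarrow> \<gamma> - inner q u < s + \<epsilon>)"
proof -
  note S = affine_weightsD(1-4)[OF aS] and up = affine_weightsD(5)[OF aS]
  define f where "f = (\<lambda>(u, y). (u, aff y u / wsup S y))"
  define A where "A = convex hull (f ` (K \<times> Y))"
  \<comment> \<open>The lift by \<epsilon> makes the two sets disjoint even where the hull touches
    \<open>S\<close>.\<close>
  define B where "B = (\<lambda>p. (0, \<epsilon>) + p) ` S"
  define G where "G = {(u, s). u \<in> K \<and> (\<forall>s'. (u, s') \<in> S \<longrightarrow> s \<le> s')}"
  have wcont: "continuous_on Y (wsup S)"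
    unfolding continuous_on_def using tendsto_wsup[OF S(1)] tendsto_ident_at by blast
  have pos: "0 < wsup S y" if "y \<in> Y" for y using that Y(3) wsup_pos[OF S(1)] by blast
  have "continuous_on (K \<times> Y) (\<lambda>p. (fst p, aff (snd p) (fst p) / wsup S (snd p)))"
    by (intro continuous_intros continuous_on_compose2[OF wcont]) (use pos in force)+
  then have "compact (f ` (K \<times> Y))"
    unfolding f_def case_prod_unfold by (intro compact_continuous_image compact_Times compact_K Y)
  then have A: "compact A" "convex A" by (auto simp: A_def compact_convex_hull)
  have "A \<noteq> {}" using Y(2) K_nonempty by (simp add: A_def)
  have B: "closed B" "convex B" using S by (auto simp: B_def closed_translation)
  \<comment> \<open>\<open>G\<close> is a hypograph over all of \<open>K\<close>, unbounded off the domain of \<open>S\<close>; it is convex only because \<open>S\<close> splits.\<close>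
  have "convex G"
  proof (rule convexI)
    fix p q :: "'a \<times> real" and \<mu> \<nu> :: real assume pq: "p \<in> G" "q \<in> G" "0 \<le> \<mu>" "0 \<le> \<nu>" "\<mu> + \<nu> = 1"
    obtain u1 s1 u2 s2 where p: "p = (u1, s1)" and q: "q = (u2, s2)" by (metis surj_pair)
    show "\<mu> *\<^sub>R p + \<nu> *\<^sub>R q \<in> G"
    proof (cases "\<nu> = 0 \<or> \<mu> = 0")
      case True
      then show ?thesis using pq by auto
    next
      case False
      have \<mu>: "\<mu> = 1 - \<nu>" "0 < \<nu>" "\<nu> < 1" using pq False by auto
      have uK: "u1 \<in> K" "u2 \<in> K" using pq p q by (auto simp: G_def)
      have "\<mu> * s1 + \<nu> * s2 \<le> s'" if s': "(\<mu> *\<^sub>R u1 + \<nu> *\<^sub>R u2, s') \<in> S" for s'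
      proof -
        obtain r1 r2 where r: "(u1, r1) \<in> S" "(u2, r2) \<in> S" "\<mu> * r1 + \<nu> * r2 \<le> s'"
          using splitsD[OF S(2) s'[unfolded \<mu>(1)] uK \<mu>(2,3)] unfolding \<mu>(1) by blast
        then have "\<mu> * s1 + \<nu> * s2 \<le> \<mu> * r1 + \<nu> * r2"
          using pq p q by (intro add_mono mult_left_mono) (auto simp: G_def)
        with r show ?thesis by simp
      qed
      moreover have "\<mu> *\<^sub>R u1 + \<nu> *\<^sub>R u2 \<in> K" using convexD[OF convex_K uK pq(3-5)] .
      ultimately show ?thesis by (simp add: G_def p q)
    qed
  qed
  moreover have "f ` (K \<times> Y) \<subseteq> G"
  proof
    fix p assume "p \<in> f ` (K \<times> Y)"
    then obtain u y where p: "p = (u, aff y u / wsup S y)" "u \<in> K" "y \<in> Y" by (auto simp: f_def)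
    have "aff y u / wsup S y \<le> s'" if "(u, s') \<in> S" for s'
      using wsup_upper[OF S(1) that, of y] pos[OF p(3)] by (simp add: pos_divide_le_eq mult.commute)
    then show "p \<in> G" using p by (simp add: G_def)
  qed
  ultimately have "A \<subseteq> G" unfolding A_def by (intro hull_minimal)
  then have "A \<inter> B = {}" using \<epsilon> by (force simp: B_def G_def)
  then obtain a \<beta> where a: "\<And>p. p \<in> A \<Longrightarrow> inner a p < \<beta>" "\<And>p. p \<in> B \<Longrightarrow> \<beta> < inner a p"
    using separating_hyperplane_compact_closed[OF A(2,1) \<open>A \<noteq> {}\<close> B(2,1)] by blast
  obtain q r where qr: "a = (q, r)" by fastforce
  have a1: "inner q u + r * (aff y u / wsup S y) < \<beta>" if "u \<in> K" "y \<in> Y" for u y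
  proof -
    have "f (u, y) \<in> A" unfolding A_def using that by (intro hull_inc imageI) auto
    then show ?thesis using a(1)[of "f (u, y)"] by (simp add: f_def qr)
  qed
  have a2: "\<beta> < inner q u + r * (s + \<epsilon>)" if "(u, s) \<in> S" for u s
    using a(2)[of "(u, \<epsilon> + s)"] that by (force simp: B_def qr add.commute)
  obtain u0 s0 where us0: "(u0, s0) \<in> S" using weightsD(1)[OF S(1)] by force
  then have u0: "u0 \<in> K" using weightsD(3)[OF S(1)] by blast
  obtain y0 where y0: "y0 \<in> Y" using Y(2) by blast
  have "r > 0"
  proof (rule ccontr)
    assume "\<not> r > 0"
    \<comment> \<open>Over a point of the domain, \<open>S\<close> contains a pair above the graph
      of \<open>aff y0 / wsup S y0\<close>; this excludes a vertical or downward separating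
      direction.\<close>
    define s where "s = max s0 (aff y0 u0 / wsup S y0)"
    have "r * (s + \<epsilon>) \<le> r * (aff y0 u0 / wsup S y0)"
      using \<open>\<not> r > 0\<close> \<epsilon> by (intro mult_left_mono_neg) (auto simp: s_def)
    moreover have "\<beta> < inner q u0 + r * (s + \<epsilon>)" using up[OF us0, of s] by (intro a2) (simp add: s_def)
    ultimately show False using a1[OF u0 y0] by simp
  qed
  have "aff y u / wsup S y < \<beta> / r - inner ((1 / r) *\<^sub>R q) u" if "u \<in> K" "y \<in> Y" for u y
    using a1[OF that] \<open>r > 0\<close> by (simp add: field_simps)
  moreover have "\<beta> / r - inner ((1 / r) *\<^sub>R q) u < s + \<epsilon>" if "(u, s) \<in> S" for u s
    using a2[OF that] \<open>r > 0\<close> by (simp add: field_simps)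
  ultimately show ?thesis by blast
qed

text \<open>The function \<open>\<kappa> * aff p\<close> has to lie above
  \<open>aff y / wsup S y\<close> for \<open>y\<close> in \<open>Y\<close> and below
  \<open>(1 + \<epsilon>) * s\<close> on \<open>S\<close>, which controls
  \<open>funk y p / \<kappa>\<close> from both sides. The estimate for \<open>aff x\<close> says
  that \<open>funk x p \<le> 1 + \<epsilon>\<close> and is what makes the detour cost small.\<close>

definition approximates where
  "approximates x S Y \<epsilon> p \<kappa> \<longleftrightarrow> p \<in> D \<and> 0 < \<kappa> \<and> dist p x < \<epsilon> \<and>
     (\<forall>u\<in>K. aff x u \<le> (1 + \<epsilon>) * aff p u) \<and>
     (\<forall>u\<in>K. \<forall>y\<in>Y. aff y u \<le> wsup S y * \<kappa> * aff p u) \<and>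
     (\<forall>u s. (u, s) \<in> S \<longrightarrow> \<kappa> * aff p u \<le> (1 + \<epsilon>) * s)"

text \<open>Adding \<open>T * aff x\<close> to the affine function between changes nothing on
  \<open>S\<close>, where \<open>aff x\<close> vanishes, and only increases it elsewhere on
  \<open>K\<close>. As \<open>T\<close> grows, the point representing the sum tends to
  \<open>x\<close> and the sum becomes comparable with its share of \<open>aff x\<close>.\<close>

lemma ex_approximates:
  assumes aS: "affine_weights S c"
    and x: "x \<in> closure D" and face: "\<And>u s. (u, s) \<in> S \<Longrightarrow> aff x u = 0"
    and Y: "compact Y" "Y \<noteq> {}" "Y \<subseteq> D" and \<epsilon>: "0 < \<epsilon>"
  shows "\<exists>p \<kappa>. approximates x S Y \<epsilon> p \<kappa>"
proof -
  note S = affine_weightsD(1-4)[OF aS]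
  have c: "0 < c" using weightsD[OF S(1)] by blast
  \<comment> \<open>All second components in \<open>S\<close> are at least \<open>c\<close>, so the
    additive tolerance \<open>c * \<epsilon>\<close> is a multiplicative one of
    \<open>1 + \<epsilon>\<close>.\<close>
  have c\<epsilon>: "0 < c * \<epsilon>" using c \<epsilon> by simp
  obtain \<gamma> q where q': "\<forall>u\<in>K. \<forall>y\<in>Y. aff y u / wsup S y < \<gamma> - inner q u"
    "\<forall>u s. (u, s) \<in> S \<longrightarrow> \<gamma> - inner q u < s + c * \<epsilon>"
    using affine_between[OF aS Y c\<epsilon>] by (elim exE conjE)
  have q: "aff y u / wsup S y < \<gamma> - inner q u" if "u \<in> K" "y \<in> Y" for u y
    using q'(1) that by blast
  have qS: "\<gamma> - inner q u < s + c * \<epsilon>" if "(u, s) \<in> S" for u s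
    using q'(2) that by blast
  obtain y0 where y0: "y0 \<in> Y" using Y(2) by blast
  have \<theta>: "0 < \<gamma> - inner q u" if "u \<in> K" for u
  proof -
    have "0 < aff y0 u / wsup S y0"
      using aff_pos that y0 Y(3) wsup_pos[OF S(1)] by (intro divide_pos_pos) auto
    with q[OF that y0] show ?thesis by simp
  qed
  from \<theta>[OF zero_K] have \<gamma>: "0 < \<gamma>" by simp
  \<comment> \<open>The expression is the point \<open>p\<close> defined below, written so that its
    limit for large \<open>T\<close> is visible.\<close>
  have "((\<lambda>T. (1 / (\<gamma> / T + 1)) *\<^sub>R ((1 / T) *\<^sub>R q + x)) \<longlongrightarrow> (1 / (0 + 1)) *\<^sub>R (0 *\<^sub>R q + x)) at_top"
    by (intro tendsto_intros real_tendsto_divide_at_top[OF tendsto_const] filterlim_ident) auto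
  then have "\<forall>\<^sub>F T in at_top. dist ((1 / (\<gamma> / T + 1)) *\<^sub>R ((1 / T) *\<^sub>R q + x)) x < \<epsilon>"
    using \<epsilon> by (intro tendstoD) auto
  moreover have "((\<lambda>T. \<gamma> / T) \<longlongrightarrow> 0) at_top"
    by (intro real_tendsto_divide_at_top[OF tendsto_const] filterlim_ident)
  then have "\<forall>\<^sub>F T in at_top. \<gamma> / T < \<epsilon>" by (rule order_tendstoD) (use \<epsilon> in simp)
  ultimately have "\<forall>\<^sub>F T in at_top. dist ((1 / (\<gamma> / T + 1)) *\<^sub>R ((1 / T) *\<^sub>R q + x)) x < \<epsilon> \<and> \<gamma> / T < \<epsilon> \<and> 0 < T"
    using eventually_gt_at_top[of 0] by eventually_elim simp
  then obtain T where T: "dist ((1 / (\<gamma> / T + 1)) *\<^sub>R ((1 / T) *\<^sub>R q + x)) x < \<epsilon>" "\<gamma> / T < \<epsilon>" "0 < T"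
    using eventually_happens by force
  define \<kappa> where "\<kappa> = \<gamma> + T"
  define p where "p = (1 / \<kappa>) *\<^sub>R (q + T *\<^sub>R x)"
  have \<kappa>: "0 < \<kappa>" "\<kappa> \<le> (1 + \<epsilon>) * T" using \<gamma> T by (auto simp: \<kappa>_def field_simps)
  have ap: "\<kappa> * aff p u = (\<gamma> - inner q u) + T * aff x u" for u
  proof -
    have "\<kappa> * aff p u = \<kappa> - inner u (q + T *\<^sub>R x)" using \<kappa> by (simp add: aff_def p_def algebra_simps)
    then show ?thesis by (simp add: \<kappa>_def aff_def inner_add_right inner_commute algebra_simps)
  qed
  have ax: "0 \<le> aff x u" if "u \<in> K" for u using x that in_closure_iff by blast
  have ge\<theta>: "\<gamma> - inner q u \<le> \<kappa> * aff p u" if "u \<in> K" for u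
    using ap[of u] ax[OF that] T(3) by simp
  have apos: "0 < aff p u" if "u \<in> K" for u
    using ge\<theta>[OF that] \<theta>[OF that] \<kappa>(1) by (smt (verit) zero_less_mult_pos)
  have "approximates x S Y \<epsilon> p \<kappa>"
    unfolding approximates_def
  proof (intro conjI ballI allI impI)
    show "p \<in> D" using apos in_D_iff by blast
    show "0 < \<kappa>" by fact
    have "p = (1 / (\<gamma> / T + 1)) *\<^sub>R ((1 / T) *\<^sub>R q + x)"
      using \<kappa>(1) T(3) unfolding p_def \<kappa>_def
      by (simp add: scaleR_add_right add_divide_distrib[symmetric] field_simps)
    then show "dist p x < \<epsilon>" using T by simp
  next
    fix u assume u: "u \<in> K"
    have "T * aff x u \<le> \<kappa> * aff p u" using ap[of u] \<theta>[OF u] by simp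
    also have "\<dots> \<le> (1 + \<epsilon>) * T * aff p u" using \<kappa>(2) apos[OF u] by (intro mult_right_mono) auto
    finally have "T * aff x u \<le> T * ((1 + \<epsilon>) * aff p u)" by (simp add: algebra_simps)
    then show "aff x u \<le> (1 + \<epsilon>) * aff p u" using T(3) by simp
  next
    fix u y assume uy: "u \<in> K" "y \<in> Y"
    have w: "0 < wsup S y" using uy Y wsup_pos[OF S(1)] by blast
    have "aff y u / wsup S y \<le> \<kappa> * aff p u" using q[OF uy] ge\<theta>[OF uy(1)] by simp
    then show "aff y u \<le> wsup S y * \<kappa> * aff p u" using w by (simp add: field_simps)
  next
    fix u s assume us: "(u, s) \<in> S"
    have "c * \<epsilon> \<le> s * \<epsilon>" using weightsD(4)[OF S(1) us] \<epsilon> by simp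
    then show "\<kappa> * aff p u \<le> (1 + \<epsilon>) * s" using ap[of u] face[OF us] qS[OF us] by (simp add: algebra_simps)
  qed
  then show ?thesis by blast
qed

section \<open>Limits of epigraphs of scaled affine functions\<close>

definition epi :: "real \<Rightarrow> 'a \<Rightarrow> ('a \<times> real) set" where
  "epi k x = {(u, s). u \<in> K \<and> k * aff x u \<le> s}"

lemma convex_epi: "0 \<le> k \<Longrightarrow> convex (epi k x)"
proof (rule convexI)
  fix p q :: "'a \<times> real" and \<mu> \<nu> :: real
  assume *: "p \<in> epi k x" "q \<in> epi k x" "0 \<le> \<mu>" "0 \<le> \<nu>" "\<mu> + \<nu> = 1"
  obtain u s v r where p: "p = (u, s)" and q: "q = (v, r)" by (metis surj_pair)
  have uv: "u \<in> K" "v \<in> K" "k * aff x u \<le> s" "k * aff x v \<le> r" using * p q by (auto simp: epi_def)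
  have \<mu>: "\<mu> = 1 - \<nu>" using *(5) by simp
  have "aff x (\<mu> *\<^sub>R u + \<nu> *\<^sub>R v) = \<mu> * aff x u + \<nu> * aff x v"
    using aff_convex_comb[of x \<nu> u v] unfolding \<mu> .
  then have "k * aff x (\<mu> *\<^sub>R u + \<nu> *\<^sub>R v) = \<mu> * (k * aff x u) + \<nu> * (k * aff x v)"
    by (simp add: algebra_simps)
  also have "\<dots> \<le> \<mu> * s + \<nu> * r" using uv * by (intro add_mono mult_left_mono)
  finally show "\<mu> *\<^sub>R p + \<nu> *\<^sub>R q \<in> epi k x"
    using convexD[OF convex_K uv(1,2) *(3-5)] by (simp add: epi_def p q)
qed

text \<open>
  Near a relative interior point \<open>w\<close> of the domain of the limit function, choose almost optimal points
  \<open>v n\<close> in faces \<open>F n\<close> of the smallest possible dimension. By minimality the \<open>v n\<close> stay uniformly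
  away from the relative boundary of \<open>F n\<close>, so the functions are uniformly bounded on \<open>F n\<close>.
  Hence the limit of the \<open>F n\<close>, which is a face by hypothesis, is the whole domain, and the limit function is affine on it.
\<close>

lemma epigraph_limit_splits:
  assumes closed_faces: "PK_closed_family {E. E face_of K}"
    and xs: "\<And>n. xs n \<in> D" and k: "\<And>n. 0 < k n"
    and PK: "PK_converges (\<lambda>n. epi (k n) (xs n)) S"
    and S: "closed S" "weights S c"
  shows "splits S"
proof -
  define \<psi> where "\<psi> n u = k n * aff (xs n) u" for n u
  have \<psi>_nonneg: "0 \<le> \<psi> n u" if "u \<in> K" for n u
    using aff_pos[OF xs that, of n] k[of n] by (simp add: \<psi>_def)
  have \<psi>_comb: "\<psi> n ((1 - t) *\<^sub>R u + t *\<^sub>R v) = (1 - t) * \<psi> n u + t * \<psi> n v" for n t u v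
    unfolding \<psi>_def aff_convex_comb by (simp add: algebra_simps)
  have \<psi>_ext: "\<psi> n (v + t *\<^sub>R (v - u)) = (1 + t) * \<psi> n v - t * \<psi> n u" for n t u v
    using \<psi>_comb[of n "-t" v u] by (simp add: algebra_simps)
  have convS: "convex S"
    using PK convex_epi k less_imp_le by (intro PK_limit_convex[OF PK]) blast
  have mem: "(v, s) \<in> S" if "strict_mono r" "\<And>n. v' n \<in> K" "\<And>n. \<psi> (r n) (v' n) \<le> \<sigma> n" "v' \<longlonglongrightarrow> v" "\<sigma> \<longlonglongrightarrow> s"
    for r v' \<sigma> v s
    by (rule PK_convergesD2[OF PK that(1), of "\<lambda>n. (v' n, \<sigma> n)"])
       (use that in \<open>auto simp: epi_def \<psi>_def intro: tendsto_Pair\<close>)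
  have convDom: "convex (fst ` S)" by (intro convex_linear_image linear_fst convS)
  have Dom_ne: "fst ` S \<noteq> {}" using weightsD(1)[OF S(2)] by simp
  have Dom_K: "fst ` S \<subseteq> K" using weightsD(3)[OF S(2)] by force
  obtain w where w: "w \<in> rel_interior (fst ` S)"
    using rel_interior_eq_empty[OF convDom] Dom_ne by blast
  then obtain s0 where "(w, s0) \<in> S" using rel_interior_subset by force
  \<comment> \<open>The value of the limit function at \<open>w\<close>; it is attained because
    \<open>S\<close> is closed.\<close>
  define m where "m = Inf {s. (w, s) \<in> S}"
  have bdd: "bdd_below {s. (w, s) \<in> S}"
    using weightsD(4)[OF S(2)] by (intro bdd_belowI[where m = c]) auto
  have "closed ((\<lambda>s. (w, s)) -` S)"
    by (intro closed_vimage S(1) continuous_intros)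
  moreover have "(\<lambda>s. (w, s)) -` S = {s. (w, s) \<in> S}" by auto
  ultimately have "m \<in> {s. (w, s) \<in> S}"
    unfolding m_def using \<open>(w, s0) \<in> S\<close> bdd by (intro closed_contains_Inf) auto
  then have wm: "(w, m) \<in> S" by simp
  have m_le: "m \<le> s" if "(w, s) \<in> S" for s
    unfolding m_def using that bdd by (intro cInf_lower) auto
  \<comment> \<open>The strict bound makes \<open>Q 0\<close> impossible, as the faces are nonempty;
    so the least \<open>j\<close> is positive and can be compared with \<open>j - 1\<close>.\<close>
  define Q where "Q j \<longleftrightarrow> (\<exists>r v \<sigma> F. strict_mono r \<and>
      (\<forall>n. F n face_of K \<and> aff_dim (F n) < int j \<and> v n \<in> F n \<and> \<psi> (r n) (v n) \<le> \<sigma> n) \<and>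
      v \<longlonglongrightarrow> w \<and> \<sigma> \<longlonglongrightarrow> m)" for j
  have "Q (Suc DIM('a))"
  proof -
    obtain ps where ps: "\<forall>\<^sub>F n in sequentially. ps n \<in> epi (k n) (xs n)" "ps \<longlonglongrightarrow> (w, m)"
      using PK wm by (rule PK_convergesD1)
    then obtain N where N: "\<And>n. n \<ge> N \<Longrightarrow> ps n \<in> epi (k n) (xs n)" by (auto simp: eventually_sequentially)
    have lim: "(\<lambda>n. ps (n + N)) \<longlonglongrightarrow> (w, m)" by (rule LIMSEQ_ignore_initial_segment[OF ps(2)])
    have "fst (ps (n + N)) \<in> K \<and> \<psi> (n + N) (fst (ps (n + N))) \<le> snd (ps (n + N))" for n
      using N[of "n + N"] by (auto simp: epi_def \<psi>_def case_prod_unfold)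
    moreover have "aff_dim K < int (Suc DIM('a))" using aff_dim_le_DIM[of K] by simp
    moreover have "strict_mono (\<lambda>n. n + N)" by (simp add: strict_mono_def)
    ultimately show ?thesis
      unfolding Q_def using tendsto_fst[OF lim] tendsto_snd[OF lim] face_of_refl[OF convex_K]
      by (intro exI[of _ "\<lambda>n. n + N"] exI[of _ "\<lambda>n. fst (ps (n + N))"] exI[of _ "\<lambda>n. snd (ps (n + N))"] exI[of _ "\<lambda>_. K"]) auto
  qed
  then obtain j where j: "Q j" "\<And>i. i < j \<Longrightarrow> \<not> Q i" using exists_least_iff[of Q] by blast
  obtain r v \<sigma> F where r: "strict_mono r" and F: "\<And>n. F n face_of K" "\<And>n. aff_dim (F n) < int j"
    and v: "\<And>n. v n \<in> F n" and \<sigma>: "\<And>n. \<psi> (r n) (v n) \<le> \<sigma> n" and lim: "v \<longlonglongrightarrow> w" "\<sigma> \<longlonglongrightarrow> m"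
    using j(1) unfolding Q_def by blast
  have FK: "F n \<subseteq> K" for n using F(1) face_of_imp_subset by blast
  have \<sigma>_nonneg: "0 \<le> \<sigma> n" for n using \<psi>_nonneg[of "v n" "r n"] \<sigma>[of n] v[of n] FK[of n] by force
  \<comment> \<open>If no such \<delta> existed, points arbitrarily close to \<open>v n\<close>
    would lie in faces of smaller dimension, with almost the same value, contradicting the choice of
    \<open>j\<close>.\<close>
  have "\<exists>\<delta>>0. \<exists>N. \<forall>n\<ge>N. \<forall>u\<in>F n. v n + \<delta> *\<^sub>R (v n - u) \<in> F n"
  proof (rule ccontr)
    assume no: "\<not> ?thesis"
    define P where "P i n \<longleftrightarrow> (\<exists>F' v'. F' face_of K \<and> aff_dim F' < aff_dim (F n) \<and> v' \<in> F' \<and>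
        dist v' (v n) \<le> 2 * radius * (1 / Suc i) \<and> \<psi> (r n) v' \<le> (1 + 1 / Suc i) * \<sigma> n)" for i n
    have "\<exists>n\<ge>N. P i n" for i N
    proof -
      define \<delta> :: real where "\<delta> = 1 / Suc i"
      have \<delta>: "0 < \<delta>" by (simp add: \<delta>_def)
      then obtain n u where n: "n \<ge> N" "u \<in> F n" "v n + \<delta> *\<^sub>R (v n - u) \<notin> F n"
        using no by meson
      have "v n + \<delta> *\<^sub>R (v n - u) \<in> affine hull F n"
      proof -
        have "(1 + \<delta>) *\<^sub>R v n + (- \<delta>) *\<^sub>R u \<in> affine hull F n"
          using v[of n] n(2) by (intro mem_affine affine_affine_hull) (auto intro: hull_inc)
        then show ?thesis by (simp add: algebra_simps)
      qed
      moreover have "compact (F n)" using face_of_imp_compact[OF convex_K compact_K F(1)] .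
      ultimately obtain d F' where d: "0 \<le> d" "d \<le> 1" "F' face_of F n" "aff_dim F' < aff_dim (F n)"
        "v n + d *\<^sub>R (v n + \<delta> *\<^sub>R (v n - u) - v n) \<in> F'"
        using exit_through_face[OF face_of_imp_convex[OF F(1)] _ v _ n(3)] by metis
      define v' where "v' = v n + (d * \<delta>) *\<^sub>R (v n - u)"
      have v': "v' \<in> F'" using d(5) by (simp add: v'_def)
      have uv: "u \<in> K" "v n \<in> K" using FK n(2) v by blast+
      have d\<delta>: "0 \<le> d * \<delta>" "d * \<delta> \<le> \<delta>" using d \<delta> by (auto intro: mult_left_le_one_le)
      have "norm (v n - u) \<le> norm (v n) + norm u" by (rule norm_triangle_ineq4)
      also have "\<dots> \<le> 2 * radius" using radius(2)[OF uv(1)] radius(2)[OF uv(2)] by simp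
      finally have "d * \<delta> * norm (v n - u) \<le> \<delta> * (2 * radius)" using d\<delta> by (intro mult_mono) auto
      then have "dist v' (v n) \<le> 2 * radius * (1 / Suc i)"
        using d(1) by (simp add: v'_def dist_norm \<delta>_def mult.commute)
      moreover have "\<psi> (r n) v' \<le> (1 + 1 / Suc i) * \<sigma> n"
      proof -
        \<comment> \<open>Moving away from \<open>u\<close> can increase a nonnegative affine
          function only by the factor of extrapolation, whatever its value at
          \<open>u\<close>.\<close>
        have "\<psi> (r n) v' = (1 + d * \<delta>) * \<psi> (r n) (v n) - d * \<delta> * \<psi> (r n) u" unfolding v'_def by (rule \<psi>_ext)
        also have "\<dots> \<le> (1 + d * \<delta>) * \<psi> (r n) (v n)" using d\<delta> \<psi>_nonneg[OF uv(1), of "r n"] by simp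
        also have "\<dots> \<le> (1 + \<delta>) * \<sigma> n" using d\<delta> \<delta> \<sigma>[of n] \<psi>_nonneg[OF uv(2), of "r n"] by (intro mult_mono) auto
        finally show ?thesis by (simp add: \<delta>_def)
      qed
      ultimately have "P i n" unfolding P_def using d(4) v' face_of_trans[OF d(3) F(1)] by blast
      then show ?thesis using n(1) by blast
    qed
    then obtain \<rho> where \<rho>: "strict_mono \<rho>" "\<And>i. P i (\<rho> i)" using choose_subseq[of P] by blast
    then obtain F' v' where F': "\<And>i. F' i face_of K" "\<And>i. aff_dim (F' i) < aff_dim (F (\<rho> i))" "\<And>i. v' i \<in> F' i"
      "\<And>i. dist (v' i) (v (\<rho> i)) \<le> 2 * radius * (1 / Suc i)" "\<And>i. \<psi> (r (\<rho> i)) (v' i) \<le> (1 + 1 / Suc i) * \<sigma> (\<rho> i)"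
      unfolding P_def by metis
    have null: "(\<lambda>i. 1 / real (Suc i)) \<longlonglongrightarrow> 0" using LIMSEQ_Suc[OF lim_1_over_n] by simp
    have "(\<lambda>i. 2 * radius * (1 / real (Suc i))) \<longlonglongrightarrow> 2 * radius * 0" by (intro tendsto_intros null)
    then have "(\<lambda>i. 2 * radius * (1 / real (Suc i))) \<longlonglongrightarrow> 0" by simp
    then have dist_null: "(\<lambda>i. dist (v' i) (v (\<rho> i))) \<longlonglongrightarrow> 0"
      by (rule tendsto_sandwich[OF always_eventually always_eventually tendsto_const, rotated 2]) (use F'(4) in auto)
    have v\<rho>: "(\<lambda>i. v (\<rho> i)) \<longlonglongrightarrow> w" using LIMSEQ_subseq_LIMSEQ[OF lim(1) \<rho>(1)] by (simp add: o_def)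
    have "(\<lambda>i. v' i - v (\<rho> i)) \<longlonglongrightarrow> 0"
      by (rule tendsto_norm_zero_cancel) (use dist_null in \<open>simp add: dist_norm\<close>)
    from tendsto_add[OF this v\<rho>] have v'_lim: "v' \<longlonglongrightarrow> w" by simp
    have \<sigma>\<rho>: "(\<lambda>i. \<sigma> (\<rho> i)) \<longlonglongrightarrow> m" using LIMSEQ_subseq_LIMSEQ[OF lim(2) \<rho>(1)] by (simp add: o_def)
    have "(\<lambda>i. (1 + 1 / real (Suc i)) * \<sigma> (\<rho> i)) \<longlonglongrightarrow> (1 + 0) * m"
      by (intro tendsto_intros null \<sigma>\<rho>)
    then have \<sigma>'_lim: "(\<lambda>i. (1 + 1 / real (Suc i)) * \<sigma> (\<rho> i)) \<longlonglongrightarrow> m" by simp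
    have "F n \<noteq> {}" for n using v by blast
    then have "0 \<le> aff_dim (F n)" for n using aff_dim_geq[of "F n"] aff_dim_empty[of "F n"] by simp
    then have "j > 0" using F(2)[of 0] by (metis le_less_trans of_nat_0_less_iff)
    have "aff_dim (F' i) < int (j - 1)" for i using F'(2)[of i] F(2)[of "\<rho> i"] \<open>j > 0\<close> by linarith
    then have "Q (j - 1)"
      unfolding Q_def using F' v'_lim \<sigma>'_lim strict_mono_o[OF r \<rho>(1)]
      by (intro exI[of _ "r \<circ> \<rho>"] exI[of _ v'] exI[of _ "\<lambda>i. (1 + 1 / Suc i) * \<sigma> (\<rho> i)"] exI[of _ F']) auto
    then show False using j(2)[of "j - 1"] \<open>j > 0\<close> by simp
  qed
  then obtain \<delta> N where \<delta>: "0 < \<delta>" and N: "\<And>n u. n \<ge> N \<Longrightarrow> u \<in> F n \<Longrightarrow> v n + \<delta> *\<^sub>R (v n - u) \<in> F n" by blast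
  obtain r1 E where r1: "strict_mono (r1 :: nat \<Rightarrow> nat)" and E: "closed E" "PK_converges ((\<lambda>n. F (n + N)) \<circ> r1) E"
    by (rule PK_convergent_subsequence)
  have E_face: "E face_of K"
    using PK_closed_familyD[OF closed_faces _ E] F(1) by simp
  define R where "R n = r1 n + N" for n
  have R: "strict_mono R" using r1 by (simp add: R_def strict_mono_def)
  define F1 v1 \<sigma>1 \<psi>1 where "F1 n = F (R n)" and "v1 n = v (R n)" and "\<sigma>1 n = \<sigma> (R n)" and "\<psi>1 n = \<psi> (r (R n))" for n
  have PK1: "PK_converges F1 E" using E(2) by (simp add: F1_def[abs_def] R_def o_def)
  have v1: "v1 n \<in> F1 n" and \<sigma>1: "\<psi>1 n (v1 n) \<le> \<sigma>1 n" for n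
    using v \<sigma> by (simp_all add: v1_def F1_def \<sigma>1_def \<psi>1_def)
  have ext1: "v1 n + \<delta> *\<^sub>R (v1 n - u) \<in> F1 n" if "u \<in> F1 n" for n u
    using N[of "R n" u] that by (simp add: v1_def F1_def R_def)
  have lim1: "v1 \<longlonglongrightarrow> w" "\<sigma>1 \<longlonglongrightarrow> m"
    using LIMSEQ_subseq_LIMSEQ[OF lim(1) R] LIMSEQ_subseq_LIMSEQ[OF lim(2) R] by (simp_all add: v1_def[abs_def] \<sigma>1_def[abs_def] o_def)
  have F1K: "F1 n \<subseteq> K" for n using FK by (simp add: F1_def)
  have mem1: "(a, s) \<in> S" if "strict_mono \<rho>" "\<And>n. a' n \<in> F1 (\<rho> n)" "\<And>n. \<psi>1 (\<rho> n) (a' n) \<le> \<tau> n" "a' \<longlonglongrightarrow> a" "\<tau> \<longlonglongrightarrow> s"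
    for \<rho> a' \<tau> a s
    using that F1K by (intro mem[OF strict_mono_o[OF r strict_mono_o[OF R that(1)]], of a' \<tau>]) (auto simp: \<psi>1_def)
  have wE: "w \<in> E" by (rule PK_convergesD2[OF PK1 strict_mono_id, of v1]) (use v1 lim1 in auto)
  obtain M where M: "\<And>n. \<sigma>1 n \<le> M"
    using lim1(2) convergent_imp_Bseq[of \<sigma>1] convergentI unfolding Bseq_def by (metis abs_le_D1 real_norm_def)
  \<comment> \<open>The bound obtained from nonnegativity at
    \<open>v1 n + \<delta> *\<^sub>R (v1 n - u)\<close>: a large value at \<open>u\<close> would
    force a negative value there.\<close>
  define C where "C = (1 + \<delta>) * M / \<delta>"
  have C: "\<psi>1 n u \<le> C" "0 \<le> \<psi>1 n u" if u: "u \<in> F1 n" for n u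
  proof -
    have "0 \<le> \<psi>1 n (v1 n + \<delta> *\<^sub>R (v1 n - u))" using ext1[OF u] F1K \<psi>_nonneg by (auto simp: \<psi>1_def)
    also have "\<dots> = (1 + \<delta>) * \<psi>1 n (v1 n) - \<delta> * \<psi>1 n u" unfolding \<psi>1_def by (rule \<psi>_ext)
    finally have "\<delta> * \<psi>1 n u \<le> (1 + \<delta>) * \<psi>1 n (v1 n)" by simp
    also have "\<dots> \<le> (1 + \<delta>) * M" using \<delta> order_trans[OF \<sigma>1 M] by (intro mult_left_mono) auto
    finally show "\<psi>1 n u \<le> C" using \<delta> by (simp add: C_def field_simps)
    show "0 \<le> \<psi>1 n u" using u F1K \<psi>_nonneg by (auto simp: \<psi>1_def)
  qed
  show ?thesis
    unfolding splits_def
  proof (intro allI impI)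
    fix u s u1 u2 and t :: real
    assume us: "(u, s) \<in> S" and uK: "u1 \<in> K" "u2 \<in> K" and t: "0 < t" "t < 1" and u: "u = (1 - t) *\<^sub>R u1 + t *\<^sub>R u2"
    have "u \<in> fst ` S" using us by force
    \<comment> \<open>As \<open>w\<close> is in the relative interior of the domain, the segment
      from \<open>u\<close> can be prolonged beyond \<open>w\<close> to \<open>v0\<close>. Then
      \<open>w\<close> in the face \<open>E\<close> puts \<open>u\<close> and \<open>v0\<close> into
      \<open>E\<close>, and next \<open>u1\<close> and \<open>u2\<close>.\<close>
    then obtain e where e: "e > 1" "(1 - e) *\<^sub>R u + e *\<^sub>R w \<in> fst ` S"
      using convex_rel_interior_iff[OF convDom Dom_ne, of w] w by blast
    define v0 where "v0 = (1 - e) *\<^sub>R u + e *\<^sub>R w"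
    define \<tau> where "\<tau> = 1 / e"
    have \<tau>: "0 < \<tau>" "\<tau> < 1" using e by (auto simp: \<tau>_def)
    have "\<tau> *\<^sub>R v0 = (\<tau> - 1) *\<^sub>R u + w" using e(1) by (simp add: v0_def \<tau>_def algebra_simps)
    then have w_eq: "w = (1 - \<tau>) *\<^sub>R u + \<tau> *\<^sub>R v0" by (simp add: algebra_simps)
    have "v0 \<in> K" "u \<in> K" using e(2) Dom_K \<open>u \<in> fst ` S\<close> by (auto simp: v0_def)
    then have "u \<in> E" and v0E: "v0 \<in> E"
      using face_of_convex_comb[OF E_face _ _ \<tau>, of u v0] wE w_eq by auto
    then have uE: "u1 \<in> E" "u2 \<in> E" using face_of_convex_comb[OF E_face uK t] u by auto
    obtain a1 where a1: "\<forall>\<^sub>F n in sequentially. a1 n \<in> F1 n" "a1 \<longlonglongrightarrow> u1" using PK1 uE(1) by (rule PK_convergesD1)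
    obtain a2 where a2: "\<forall>\<^sub>F n in sequentially. a2 n \<in> F1 n" "a2 \<longlonglongrightarrow> u2" using PK1 uE(2) by (rule PK_convergesD1)
    obtain a0 where a0: "\<forall>\<^sub>F n in sequentially. a0 n \<in> F1 n" "a0 \<longlonglongrightarrow> v0" using PK1 v0E by (rule PK_convergesD1)
    have "\<forall>\<^sub>F n in sequentially. a1 n \<in> F1 n \<and> a2 n \<in> F1 n \<and> a0 n \<in> F1 n"
      using a1(1) a2(1) a0(1) by eventually_elim simp
    then obtain N0 where N0: "\<And>n. n \<ge> N0 \<Longrightarrow> a1 n \<in> F1 n \<and> a2 n \<in> F1 n \<and> a0 n \<in> F1 n"
      by (auto simp: eventually_sequentially)
    define z where "z n = (\<psi>1 (n + N0) (a1 (n + N0)), \<psi>1 (n + N0) (a2 (n + N0)), \<psi>1 (n + N0) (a0 (n + N0)))" for n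
    have "compact ({0..C} \<times> {0..C} \<times> {0..C})" by (intro compact_Times compact_Icc)
    moreover have "z n \<in> {0..C} \<times> {0..C} \<times> {0..C}" for n using N0[of "n + N0"] C by (auto simp: z_def)
    ultimately obtain l r2 where r2: "strict_mono (r2 :: nat \<Rightarrow> nat)" and l: "(z \<circ> r2) \<longlonglongrightarrow> l"
      unfolding compact_def by meson
    obtain s1 s2 s3 where l_eq: "l = (s1, s2, s3)" by (metis surj_pair)
    define \<rho> where "\<rho> n = r2 n + N0" for n
    have \<rho>: "strict_mono \<rho>" using r2 by (simp add: \<rho>_def strict_mono_def)
    have in1: "a1 (\<rho> n) \<in> F1 (\<rho> n)" "a2 (\<rho> n) \<in> F1 (\<rho> n)" "a0 (\<rho> n) \<in> F1 (\<rho> n)" for n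
      using N0[of "\<rho> n"] by (auto simp: \<rho>_def)
    have ls: "(\<lambda>n. \<psi>1 (\<rho> n) (a1 (\<rho> n))) \<longlonglongrightarrow> s1" "(\<lambda>n. \<psi>1 (\<rho> n) (a2 (\<rho> n))) \<longlonglongrightarrow> s2" "(\<lambda>n. \<psi>1 (\<rho> n) (a0 (\<rho> n))) \<longlonglongrightarrow> s3"
      using tendsto_fst[OF l] tendsto_fst[OF tendsto_snd[OF l]] tendsto_snd[OF tendsto_snd[OF l]]
      by (simp_all add: z_def \<rho>_def l_eq o_def)
    have la: "(\<lambda>n. a1 (\<rho> n)) \<longlonglongrightarrow> u1" "(\<lambda>n. a2 (\<rho> n)) \<longlonglongrightarrow> u2" "(\<lambda>n. a0 (\<rho> n)) \<longlonglongrightarrow> v0"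
        "(\<lambda>n. v1 (\<rho> n)) \<longlonglongrightarrow> w" "(\<lambda>n. \<sigma>1 (\<rho> n)) \<longlonglongrightarrow> m"
      using LIMSEQ_subseq_LIMSEQ[OF a1(2) \<rho>] LIMSEQ_subseq_LIMSEQ[OF a2(2) \<rho>] LIMSEQ_subseq_LIMSEQ[OF a0(2) \<rho>]
        LIMSEQ_subseq_LIMSEQ[OF lim1(1) \<rho>] LIMSEQ_subseq_LIMSEQ[OF lim1(2) \<rho>] by (simp_all add: o_def)
    have S1: "(u1, s1) \<in> S" by (rule mem1[OF \<rho> in1(1) order_refl la(1) ls(1)])
    have S2: "(u2, s2) \<in> S" by (rule mem1[OF \<rho> in1(2) order_refl la(2) ls(2)])
    have S3: "(v0, s3) \<in> S" by (rule mem1[OF \<rho> in1(3) order_refl la(3) ls(3)])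
    \<comment> \<open>The combination of points of the face \<open>F1 (\<rho> n)\<close> that mimics
      \<open>w\<close> as a combination of \<open>u1\<close>, \<open>u2\<close> and
      \<open>v0\<close>.\<close>
    define w' where "w' n = (1 - \<tau>) *\<^sub>R ((1 - t) *\<^sub>R a1 (\<rho> n) + t *\<^sub>R a2 (\<rho> n)) + \<tau> *\<^sub>R a0 (\<rho> n)" for n
    define \<Lambda> where "\<Lambda> n = (1 - \<tau>) * ((1 - t) * \<psi>1 (\<rho> n) (a1 (\<rho> n)) + t * \<psi>1 (\<rho> n) (a2 (\<rho> n))) + \<tau> * \<psi>1 (\<rho> n) (a0 (\<rho> n))" for n
    have \<Lambda>: "\<psi>1 (\<rho> n) (w' n) = \<Lambda> n" for n unfolding w'_def \<Lambda>_def \<psi>1_def \<psi>_comb ..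
    have "convex (F1 n)" for n using F(1) face_of_imp_convex by (auto simp: F1_def)
    then have w': "w' n \<in> F1 (\<rho> n)" for n
      unfolding w'_def using in1 t \<tau> by (intro convexD[of "F1 (\<rho> n)"]) auto
    have lim_w': "w' \<longlonglongrightarrow> w"
      unfolding w'_def using la by (subst w_eq, subst u) (intro tendsto_intros)
    \<comment> \<open>Reflecting \<open>w' n\<close> beyond \<open>v1 (\<rho> n)\<close> again gives
      points tending to \<open>w\<close>. Minimality of \<open>m\<close> thus bounds the limit of
      the values at \<open>w' n\<close> from above by \<open>m\<close>, while convexity of
      \<open>S\<close> bounds \<open>m\<close> by the combination of \<open>s\<close> and
      \<open>s3\<close>; the term with \<open>s3\<close> cancels.\<close>
    have "(w, (1 + \<delta>) * m - \<delta> * ((1 - \<tau>) * ((1 - t) * s1 + t * s2) + \<tau> * s3)) \<in> S"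
    proof (rule mem1[OF \<rho> ext1[OF w']])
      show "\<psi>1 (\<rho> n) (v1 (\<rho> n) + \<delta> *\<^sub>R (v1 (\<rho> n) - w' n)) \<le> (1 + \<delta>) * \<sigma>1 (\<rho> n) - \<delta> * \<Lambda> n" for n
      proof -
        have "\<psi>1 (\<rho> n) (v1 (\<rho> n) + \<delta> *\<^sub>R (v1 (\<rho> n) - w' n)) = (1 + \<delta>) * \<psi>1 (\<rho> n) (v1 (\<rho> n)) - \<delta> * \<Lambda> n"
          unfolding \<Lambda>[symmetric] unfolding \<psi>1_def by (rule \<psi>_ext)
        then show ?thesis using \<sigma>1[of "\<rho> n"] \<delta> by simp
      qed
      have "(\<lambda>n. v1 (\<rho> n) + \<delta> *\<^sub>R (v1 (\<rho> n) - w' n)) \<longlonglongrightarrow> w + \<delta> *\<^sub>R (w - w)"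
        by (intro tendsto_intros la lim_w')
      then show "(\<lambda>n. v1 (\<rho> n) + \<delta> *\<^sub>R (v1 (\<rho> n) - w' n)) \<longlonglongrightarrow> w" by simp
      show "(\<lambda>n. (1 + \<delta>) * \<sigma>1 (\<rho> n) - \<delta> * \<Lambda> n) \<longlonglongrightarrow> (1 + \<delta>) * m - \<delta> * ((1 - \<tau>) * ((1 - t) * s1 + t * s2) + \<tau> * s3)"
        unfolding \<Lambda>_def by (intro tendsto_intros la ls)
    qed
    then have "m \<le> (1 + \<delta>) * m - \<delta> * ((1 - \<tau>) * ((1 - t) * s1 + t * s2) + \<tau> * s3)" by (rule m_le)
    then have "\<delta> * ((1 - \<tau>) * ((1 - t) * s1 + t * s2) + \<tau> * s3) \<le> \<delta> * m" by (simp add: algebra_simps)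
    then have "(1 - \<tau>) * ((1 - t) * s1 + t * s2) + \<tau> * s3 \<le> m" using \<delta> by simp
    also have "m \<le> (1 - \<tau>) * s + \<tau> * s3"
    proof (rule m_le)
      have "(1 - \<tau>) *\<^sub>R (u, s) + \<tau> *\<^sub>R (v0, s3) \<in> S"
        using \<tau> by (intro convexD[OF convS us S3]) auto
      then show "(w, (1 - \<tau>) * s + \<tau> * s3) \<in> S" using w_eq by simp
    qed
    finally have "(1 - \<tau>) * ((1 - t) * s1 + t * s2) \<le> (1 - \<tau>) * s" by simp
    then have "(1 - t) * s1 + t * s2 \<le> s" using \<tau> by simp
    then show "\<exists>s1 s2. (u1, s1) \<in> S \<and> (u2, s2) \<in> S \<and> (1 - t) * s1 + t * s2 \<le> s" using S1 S2 by blast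
  qed
qed

section \<open>From affine approximations to convergent sequences\<close>

lemma tendsto_funk_ratio_imp_hconverges:
  assumes b: "b \<in> D" and p: "\<And>n. p n \<in> D" "p \<longlonglongrightarrow> x" and \<kappa>: "\<And>n. 0 < \<kappa> n"
    and lim: "\<And>y. y \<in> D \<Longrightarrow> (\<lambda>n. funk y (p n) / \<kappa> n) \<longlonglongrightarrow> wsup S y" and S: "weights S c"
  shows "hconverges D b p (funk_horo b x S)"
  unfolding hconverges_def
proof (intro conjI allI ballI)
  fix y assume y: "y \<in> D"
  have ln1: "(\<lambda>n. ln (funk (p n) z)) \<longlonglongrightarrow> ln (funk x z)" if "z \<in> D" for z
    using funk_pos[OF that, of x] by (intro tendsto_ln tendsto_funk[OF that p(2)]) simp
  have ln2: "(\<lambda>n. ln (funk z (p n)) - ln (\<kappa> n)) \<longlonglongrightarrow> ln (wsup S z)" if "z \<in> D" for z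
  proof -
    have "(\<lambda>n. ln (funk z (p n) / \<kappa> n)) \<longlonglongrightarrow> ln (wsup S z)"
      using wsup_pos[OF S that] by (intro tendsto_ln lim[OF that]) simp
    moreover have "ln (funk z (p n) / \<kappa> n) = ln (funk z (p n)) - ln (\<kappa> n)" for n
      using funk_pos[OF p(1), of z n] \<kappa>[of n] by (simp add: ln_div)
    ultimately show ?thesis by simp
  qed
  \<comment> \<open>The scale \<open>\<kappa> n\<close> is common to \<open>y\<close> and
    \<open>b\<close> and cancels in the difference.\<close>
  have "(\<lambda>n. (ln (funk (p n) y) - ln (funk (p n) b)) + (ln (funk y (p n)) - ln (\<kappa> n)) - (ln (funk b (p n)) - ln (\<kappa> n)))
      \<longlonglongrightarrow> (ln (funk x y) - ln (funk x b)) + ln (wsup S y) - ln (wsup S b)"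
    by (intro tendsto_intros ln1 ln2 y b)
  then show "(\<lambda>n. hdist y (p n) - hdist b (p n)) \<longlonglongrightarrow> funk_horo b x S y"
    using y b p(1) by (simp add: hilbert_dist_eq funk_horo_def algebra_simps)
qed (rule p)

lemma approximates_funk_le:
  assumes "approximates x S Y \<epsilon> p \<kappa>" "y \<in> Y"
  shows "funk y p / \<kappa> \<le> wsup S y"
proof -
  have p: "p \<in> D" and \<kappa>: "0 < \<kappa>" using assms by (auto simp: approximates_def)
  have "funk y p \<le> wsup S y * \<kappa>"
    by (rule funk_least[OF p]) (use assms in \<open>auto simp: approximates_def\<close>)
  then show ?thesis using \<kappa> by (simp add: pos_divide_le_eq)
qed

lemma approximates_wsup_le:
  assumes "approximates x S Y \<epsilon> p \<kappa>" "weights S c"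
  shows "wsup S y \<le> (1 + \<epsilon>) * (funk y p / \<kappa>)"
proof (rule wsup_least[OF assms(2)])
  fix u s assume us: "(u, s) \<in> S"
  have p: "p \<in> D" and \<kappa>: "0 < \<kappa>" and le: "\<kappa> * aff p u \<le> (1 + \<epsilon>) * s"
    using assms(1) us by (auto simp: approximates_def)
  have "aff y u \<le> funk y p * aff p u" by (rule funk_upper[OF p weightsD(3)[OF assms(2) us]])
  also have "\<dots> = funk y p / \<kappa> * (\<kappa> * aff p u)" using \<kappa> by simp
  also have "\<dots> \<le> funk y p / \<kappa> * ((1 + \<epsilon>) * s)"
    using le \<kappa> funk_pos[OF p, of y] by (intro mult_left_mono) auto
  finally show "aff y u \<le> (1 + \<epsilon>) * (funk y p / \<kappa>) * s" by (simp add: mult_ac)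
qed

text \<open>Boundary point and weights may vary with \<open>n\<close>: constant ones give a sequence
  for a single horofunction, varying ones turn faces tending to a set into one sequence for the
  limit set.\<close>

lemma approximates_hconverges:
  assumes b: "b \<in> D" and \<epsilon>: "\<And>n. 0 < \<epsilon> n" "\<epsilon> \<longlonglongrightarrow> 0" and x: "xs \<longlonglongrightarrow> x"
    and ap: "\<And>n. approximates (xs n) (Ss n) (Ys n) (\<epsilon> n) (p n) (\<kappa> n)"
    and Ys: "\<And>y. y \<in> D \<Longrightarrow> \<forall>\<^sub>F n in sequentially. y \<in> Ys n"
    and Ss: "\<And>n. weights (Ss n) c" "\<And>y. y \<in> D \<Longrightarrow> (\<lambda>n. wsup (Ss n) y) \<longlonglongrightarrow> wsup S y" and S: "weights S c"
  shows "hconverges D b p (funk_horo b x S)" "p \<longlonglongrightarrow> x"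
proof -
  have p: "p n \<in> D" and \<kappa>: "0 < \<kappa> n" and d: "dist (p n) (xs n) < \<epsilon> n" for n
    using ap[of n] by (auto simp: approximates_def)
  have "(\<lambda>n. dist (p n) (xs n)) \<longlonglongrightarrow> 0"
    by (rule tendsto_sandwich[OF always_eventually always_eventually tendsto_const \<epsilon>(2)])
      (use d less_imp_le in auto)
  then have "(\<lambda>n. p n - xs n) \<longlonglongrightarrow> 0"
    by (intro tendsto_norm_zero_cancel[of "\<lambda>n. p n - xs n"]) (simp add: dist_norm)
  from tendsto_add[OF this x] show px: "p \<longlonglongrightarrow> x" by simp
  have lim: "(\<lambda>n. funk y (p n) / \<kappa> n) \<longlonglongrightarrow> wsup S y" if y: "y \<in> D" for y
  proof (rule tendsto_sandwich)
    show "\<forall>\<^sub>F n in sequentially. wsup (Ss n) y / (1 + \<epsilon> n) \<le> funk y (p n) / \<kappa> n"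
    proof (intro always_eventually allI)
      fix n
      have "wsup (Ss n) y \<le> (1 + \<epsilon> n) * (funk y (p n) / \<kappa> n)"
        by (rule approximates_wsup_le[OF ap Ss(1)])
      moreover have "0 < 1 + \<epsilon> n" using \<epsilon>(1)[of n] by simp
      ultimately show "wsup (Ss n) y / (1 + \<epsilon> n) \<le> funk y (p n) / \<kappa> n"
        by (simp add: pos_divide_le_eq mult.commute)
    qed
    show "\<forall>\<^sub>F n in sequentially. funk y (p n) / \<kappa> n \<le> wsup (Ss n) y"
      using Ys[OF y] by eventually_elim (rule approximates_funk_le[OF ap])
    have "(\<lambda>n. wsup (Ss n) y / (1 + \<epsilon> n)) \<longlonglongrightarrow> wsup S y / (1 + 0)"
      by (intro tendsto_intros Ss(2)[OF y] \<epsilon>(2)) simp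
    then show "(\<lambda>n. wsup (Ss n) y / (1 + \<epsilon> n)) \<longlonglongrightarrow> wsup S y" by simp
  qed (rule Ss(2)[OF y])
  show "hconverges D b p (funk_horo b x S)"
    by (rule tendsto_funk_ratio_imp_hconverges[OF b p px \<kappa> lim S])
qed

text \<open>Including \<open>b\<close> in every compact set keeps the sets nonempty and makes the
  upper estimate at \<open>b\<close> valid for each \<open>n\<close>.\<close>

lemma exhaustion:
  assumes "b \<in> D"
  obtains Ys where "\<forall>n. compact (Ys n) \<and> b \<in> Ys n \<and> Ys n \<subseteq> D"
    "\<forall>y\<in>D. \<forall>\<^sub>F n in sequentially. y \<in> Ys n"
proof (rule open_Union_compact_subsets[OF open_D])
  fix C :: "nat \<Rightarrow> 'a set"
  assume C: "\<And>n. compact (C n)" "\<And>n. C n \<subseteq> D" "\<And>n. C n \<subseteq> interior (C (Suc n))" "\<Union> (range C) = D"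
    "\<And>L. \<lbrakk>compact L; L \<subseteq> D\<rbrakk> \<Longrightarrow> \<exists>N. \<forall>n\<ge>N. L \<subseteq> C n"
  have "\<forall>\<^sub>F n in sequentially. y \<in> insert b (C n)" if "y \<in> D" for y
    using C(5)[of "{y}"] that by (auto simp: eventually_sequentially)
  moreover have "compact (insert b (C n)) \<and> b \<in> insert b (C n) \<and> insert b (C n) \<subseteq> D" for n
    using C(1,2) assms by (simp add: compact_insert)
  ultimately show thesis by (intro that[of "\<lambda>n. insert b (C n)"]) auto
qed

text \<open>In the detour cost \<open>\<kappa> n\<close> cancels between
  \<open>funk b (p n)\<close>, at most \<open>wsup S b * \<kappa> n\<close>, and
  \<open>wsup S (p n)\<close>, at most \<open>(1 + \<epsilon> n) / \<kappa> n\<close>. What is left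
  is \<open>funk x (p n)\<close>, at most \<open>1 + \<epsilon> n\<close>, and the ratio of
  \<open>funk (p n) b\<close> to its limit \<open>funk x b\<close>.\<close>

lemma affine_weights_imp_no_detour:
  assumes b: "b \<in> D" and S: "affine_weights S c"
    and x: "x \<in> closure D" and face: "\<forall>p\<in>S. aff x (fst p) = 0"
  obtains p where "hconverges D b p (funk_horo b x S)"
    "\<forall>\<delta>>0. \<forall>\<^sub>F n in sequentially. hdist b (p n) + funk_horo b x S (p n) < \<delta>"
proof -
  have W: "weights S c" using affine_weightsD(1)[OF S] .
  obtain Ys where Ys': "\<forall>n. compact (Ys n) \<and> b \<in> Ys n \<and> Ys n \<subseteq> D"
    "\<forall>y\<in>D. \<forall>\<^sub>F n in sequentially. y \<in> Ys n"
    by (rule exhaustion[OF b])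
  have Ys: "compact (Ys n)" "b \<in> Ys n" "Ys n \<subseteq> D" "y \<in> D \<Longrightarrow> \<forall>\<^sub>F n in sequentially. y \<in> Ys n" for n y
    using Ys' by blast+
  define \<epsilon> :: "nat \<Rightarrow> real" where "\<epsilon> n = 1 / Suc n" for n
  have \<epsilon>: "0 < \<epsilon> n" for n by (simp add: \<epsilon>_def)
  have \<epsilon>0: "\<epsilon> \<longlonglongrightarrow> 0" using LIMSEQ_Suc[OF lim_1_over_n] by (simp add: \<epsilon>_def[abs_def])
  have "\<exists>p \<kappa>. approximates x S (Ys n) (\<epsilon> n) p \<kappa>" for n
    using Ys(2)[of n] face by (intro ex_approximates[OF S x _ Ys(1) _ Ys(3) \<epsilon>]) force+
  then obtain p \<kappa> where ap: "\<And>n. approximates x S (Ys n) (\<epsilon> n) (p n) (\<kappa> n)" by metis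
  have conv: "hconverges D b p (funk_horo b x S)" "p \<longlonglongrightarrow> x"
    using approximates_hconverges[OF b \<epsilon> \<epsilon>0 tendsto_const ap Ys(4) W tendsto_const W] by auto
  have "hdist b (p n) + funk_horo b x S (p n) \<le> 2 * ln (1 + \<epsilon> n) + (ln (funk (p n) b) - ln (funk x b))" for n
  proof -
    have p: "p n \<in> D" and \<kappa>: "0 < \<kappa> n" and le: "\<And>u. u \<in> K \<Longrightarrow> aff x u \<le> (1 + \<epsilon> n) * aff (p n) u"
      and leS: "\<And>u s. (u, s) \<in> S \<Longrightarrow> \<kappa> n * aff (p n) u \<le> (1 + \<epsilon> n) * s"
      using ap[of n] by (auto simp: approximates_def)
    have "funk x (p n) \<le> 1 + \<epsilon> n" using le by (rule funk_least[OF p])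
    then have 1: "ln (funk x (p n)) \<le> ln (1 + \<epsilon> n)" using funk_pos[OF p, of x] \<epsilon>[of n] by simp
    have "funk b (p n) / \<kappa> n \<le> wsup S b" by (rule approximates_funk_le[OF ap Ys(2)])
    then have "ln (funk b (p n) / \<kappa> n) \<le> ln (wsup S b)"
      using funk_pos[OF p, of b] \<kappa> wsup_pos[OF W b] by simp
    then have 2: "ln (funk b (p n)) - ln (\<kappa> n) \<le> ln (wsup S b)"
      using funk_pos[OF p, of b] \<kappa> by (simp add: ln_div)
    have "wsup S (p n) \<le> (1 + \<epsilon> n) / \<kappa> n"
    proof (rule wsup_least[OF W])
      fix u s assume "(u, s) \<in> S"
      from leS[OF this] show "aff (p n) u \<le> (1 + \<epsilon> n) / \<kappa> n * s" using \<kappa> by (simp add: field_simps)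
    qed
    then have "ln (wsup S (p n)) \<le> ln ((1 + \<epsilon> n) / \<kappa> n)"
      using wsup_pos[OF W p] by simp
    then have 3: "ln (wsup S (p n)) \<le> ln (1 + \<epsilon> n) - ln (\<kappa> n)"
      using \<epsilon>[of n] \<kappa> by (simp add: ln_div)
    show ?thesis using 1 2 3 by (simp add: hilbert_dist_eq[OF b p] funk_horo_def)
  qed
  note bound = this
  have "(\<lambda>n. 2 * ln (1 + \<epsilon> n) + (ln (funk (p n) b) - ln (funk x b))) \<longlonglongrightarrow> 2 * ln (1 + 0) + (ln (funk x b) - ln (funk x b))"
    using funk_pos[OF b, of x] by (intro tendsto_intros \<epsilon>0 tendsto_funk[OF b conv(2)]) auto
  then have lim: "(\<lambda>n. 2 * ln (1 + \<epsilon> n) + (ln (funk (p n) b) - ln (funk x b))) \<longlonglongrightarrow> 0" by simp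
  have "\<forall>\<^sub>F n in sequentially. hdist b (p n) + funk_horo b x S (p n) < \<delta>" if "0 < \<delta>" for \<delta>
    using order_tendstoD(2)[OF lim that]
  proof eventually_elim
    case (elim n)
    with bound[of n] show ?case by linarith
  qed
  then show ?thesis using that[OF conv(1)] by blast
qed

text \<open>The scale \<open>funk b (X n)\<close> is the least one for which the multiple of
  \<open>aff (X n)\<close> dominates \<open>aff b\<close> on \<open>K\<close>. It keeps all
  epigraphs above a positive level, and \<open>b\<close> itself yields a point in their
  limit.\<close>

lemma horofunction_limit:
  assumes b: "b \<in> D" and g: "horofunction D b g"
  obtains x X k S c where "x \<in> frontier D" "\<forall>n. X n \<in> D" "\<forall>n. 0 < k n"
    "PK_converges (\<lambda>n. epi (k n) (X n)) S" "closed S" "weights S c"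
    "\<forall>p\<in>S. aff x (fst p) = 0" "\<forall>y\<in>D. g y = funk_horo b x S y"
proof -
  obtain xs where xs: "hconverges D b xs g" using g by (auto simp: horofunction_def)
  have "compact (closure D)" using bounded_D by (simp add: compact_closure)
  moreover have "xs n \<in> closure D" for n using xs closure_subset by (auto simp: hconverges_def)
  ultimately obtain x r0 where x: "x \<in> closure D" and r0: "strict_mono (r0 :: nat \<Rightarrow> nat)" "(xs \<circ> r0) \<longlonglongrightarrow> x"
    unfolding compact_def by meson
  define X0 where "X0 = xs \<circ> r0"
  obtain r1 S where r1: "strict_mono (r1 :: nat \<Rightarrow> nat)" and clS: "closed S"
    and PK0: "PK_converges ((\<lambda>n. epi (funk b (X0 n)) (X0 n)) \<circ> r1) S"
    by (rule PK_convergent_subsequence)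
  define X where "X = X0 \<circ> r1"
  define k where "k n = funk b (X n)" for n
  have PK: "PK_converges (\<lambda>n. epi (k n) (X n)) S" using PK0 by (simp add: X_def k_def o_def)
  have XD: "X n \<in> D" for n using xs by (simp add: X_def X0_def hconverges_def)
  have Xx: "X \<longlonglongrightarrow> x" using LIMSEQ_subseq_LIMSEQ[OF r0(2) r1] by (simp add: X_def X0_def)
  have Xg: "(\<lambda>n. hdist y (X n) - hdist b (X n)) \<longlonglongrightarrow> g y" if "y \<in> D" for y
  proof -
    have "(\<lambda>n. hdist y (xs n) - hdist b (xs n)) \<longlonglongrightarrow> g y" using xs that by (simp add: hconverges_def)
    from LIMSEQ_subseq_LIMSEQ[OF this strict_mono_o[OF r0(1) r1]] show ?thesis by (simp add: X_def X0_def o_def)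
  qed
  have kpos: "0 < k n" for n using funk_pos[OF XD] by (simp add: k_def)
  \<comment> \<open>An interior limit would make \<open>g\<close> the normalised distance function
    of \<open>x\<close>, which a horofunction is not.\<close>
  have "x \<notin> D"
  proof
    assume xD: "x \<in> D"
    have "(\<lambda>n. ln (funk x (X n)) + ln (funk (X n) x)) \<longlonglongrightarrow> ln 1 + ln (funk x x)"
      using funk_refl[OF xD] by (intro tendsto_intros tendsto_funk_right_1[OF XD Xx xD] tendsto_funk[OF xD Xx]) auto
    then have dx: "(\<lambda>n. hdist x (X n)) \<longlonglongrightarrow> 0" using funk_refl[OF xD] hilbert_dist_eq[OF xD XD] by simp
    have lim: "(\<lambda>n. hdist y (X n)) \<longlonglongrightarrow> hdist y x" if y: "y \<in> D" for y
    proof (rule LIM_zero_cancel, rule tendsto_rabs_zero_cancel, rule tendsto_sandwich[OF always_eventually always_eventually tendsto_const dx])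
      have "hdist y (X n) \<le> hdist y x + hdist x (X n)" "hdist y x \<le> hdist y (X n) + hdist x (X n)" for n
        using hdist_triangle[OF y xD XD, of n] hdist_triangle[OF y XD xD, of n] hdist_commute[OF xD XD, of n] by auto
      then show "\<forall>n. \<bar>hdist y (X n) - hdist y x\<bar> \<le> hdist x (X n)" by (auto simp: abs_le_iff algebra_simps)
    qed simp
    have "g y = hdist y x - hdist b x" if "y \<in> D" for y
      using LIMSEQ_unique[OF Xg[OF that] tendsto_diff[OF lim[OF that] lim[OF b]]] .
    then show False using g xD by (auto simp: horofunction_def)
  qed
  then have xf: "x \<in> frontier D" using x open_D by (simp add: frontier_def interior_open)
  define \<alpha> where "\<alpha> y n = funk y (X n) / k n" for y n
  have \<alpha>pos: "0 < \<alpha> y n" for y n using funk_pos[OF XD, of y n] kpos[of n] by (simp add: \<alpha>_def)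
  \<comment> \<open>Solved from the formula for the Hilbert distance: \<open>g\<close> and the
    continuous Funk half determine the limit of the other half.\<close>
  define l where "l y = exp (g y - ln (funk x y) + ln (funk x b))" for y
  have lpos: "0 < l y" for y by (simp add: l_def)
  have \<alpha>l: "\<alpha> y \<longlonglongrightarrow> l y" if y: "y \<in> D" for y
  proof -
    have "(\<lambda>n. exp ((hdist y (X n) - hdist b (X n)) - ln (funk (X n) y) + ln (funk (X n) b))) \<longlonglongrightarrow> l y"
      unfolding l_def using funk_pos[OF y, of x] funk_pos[OF b, of x]
      by (intro tendsto_intros Xg[OF y] tendsto_funk[OF y Xx] tendsto_funk[OF b Xx]) auto
    moreover have "exp ((hdist y (X n) - hdist b (X n)) - ln (funk (X n) y) + ln (funk (X n) b)) = \<alpha> y n" for n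
      using funk_pos[OF XD, of y n] funk_pos[OF XD, of b n]
      by (simp add: hilbert_dist_eq[OF y XD] hilbert_dist_eq[OF b XD] exp_diff \<alpha>_def k_def)
    ultimately show ?thesis by (simp add: \<alpha>_def[abs_def])
  qed
  obtain c where c: "0 < c" "\<And>u. u \<in> K \<Longrightarrow> c \<le> aff b u" using aff_lower_bound[OF b] by blast
  have "epi (k n) (X n) \<subseteq> K \<times> {c..}" for n
    using funk_upper[OF XD, of _ b n] c(2) by (force simp: epi_def k_def)
  then have SK: "S \<subseteq> K \<times> {c..}"
    using PK_limit_subset[OF PK] closed_Times[OF closed_K closed_atLeast] by blast
  \<comment> \<open>Points where the maximum defining \<open>funk y (X n)\<close> is attained
    accumulate at a point of \<open>S\<close> that realises \<open>l y\<close>.\<close>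
  have ex: "\<exists>u. (u, aff y u / l y) \<in> S" if y: "y \<in> D" for y
  proof -
    have "\<exists>u. u \<in> K \<and> aff y u = funk y (X n) * aff (X n) u" for n using funk_attained[OF XD, of y n] by metis
    then obtain u where u: "\<And>n. u n \<in> K" "\<And>n. aff y (u n) = funk y (X n) * aff (X n) (u n)" by metis
    obtain u0 r where r: "strict_mono (r :: nat \<Rightarrow> nat)" "(u \<circ> r) \<longlonglongrightarrow> u0"
      using compact_K u(1) unfolding compact_def by meson
    have in_epi: "(u n, aff y (u n) / \<alpha> y n) \<in> epi (k n) (X n)" for n
      using u[of n] funk_pos[OF XD, of y n] kpos[of n] by (simp add: epi_def \<alpha>_def)
    have "(\<lambda>n. (u (r n), aff y (u (r n)) / \<alpha> y (r n))) \<longlonglongrightarrow> (u0, aff y u0 / l y)"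
      using r(2) LIMSEQ_subseq_LIMSEQ[OF \<alpha>l[OF y] r(1)] lpos[of y] by (intro tendsto_intros) (auto simp: o_def)
    then show ?thesis using PK_convergesD2[OF PK r(1) in_epi] by blast
  qed
  have W: "weights S c" using ex[OF b] SK c(1) by (auto simp: weights_def)
  have le: "aff y u \<le> l y * s" if y: "y \<in> D" and us: "(u, s) \<in> S" for y u s
  proof -
    obtain ps where ps: "\<forall>\<^sub>F n in sequentially. ps n \<in> epi (k n) (X n)" "ps \<longlonglongrightarrow> (u, s)"
      using PK us by (rule PK_convergesD1)
    have ev: "\<forall>\<^sub>F n in sequentially. aff y (fst (ps n)) \<le> \<alpha> y n * snd (ps n)"
      using ps(1)
    proof eventually_elim
      case (elim n)
      then have el: "fst (ps n) \<in> K" "k n * aff (X n) (fst (ps n)) \<le> snd (ps n)" by (auto simp: epi_def case_prod_unfold)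
      have "aff y (fst (ps n)) \<le> funk y (X n) * aff (X n) (fst (ps n))" by (rule funk_upper[OF XD el(1)])
      also have "\<dots> = \<alpha> y n * (k n * aff (X n) (fst (ps n)))" using kpos[of n] by (simp add: \<alpha>_def)
      also have "\<dots> \<le> \<alpha> y n * snd (ps n)" using el(2) \<alpha>pos[of y n] by (intro mult_left_mono) auto
      finally show ?case .
    qed
    have "(\<lambda>n. aff y (fst (ps n))) \<longlonglongrightarrow> aff y (fst (u, s))" by (intro tendsto_intros ps(2))
    moreover have "(\<lambda>n. \<alpha> y n * snd (ps n)) \<longlonglongrightarrow> l y * snd (u, s)" by (intro tendsto_intros ps(2) \<alpha>l[OF y])
    ultimately show ?thesis using tendsto_le[OF trivial_limit_sequentially _ _ ev] by fastforce
  qed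
  have l_eq: "l y = wsup S y" if y: "y \<in> D" for y
  proof (rule antisym)
    show "wsup S y \<le> l y" by (rule wsup_least[OF W le[OF y]])
    obtain u where u: "(u, aff y u / l y) \<in> S" using ex[OF y] by blast
    have "0 < aff y u" using aff_pos[OF y weightsD(3)[OF W u]] .
    then show "l y \<le> wsup S y" using wsup_upper[OF W u, of y] lpos[of y] by (simp add: field_simps)
  qed
  \<comment> \<open>At a zero \<open>u0\<close> of \<open>aff x\<close> the scaled functions still
    dominate \<open>aff b u0 > 0\<close>, so the scales blow up; hence values stay finite only where
    \<open>aff x\<close> vanishes. The products below express this without dividing by quantities
    that tend to 0.\<close>
  have face: "aff x u = 0" if us: "(u, s) \<in> S" for u s
  proof -
    obtain u0 where u0: "u0 \<in> K" "aff x u0 = 0" using frontier_zeroE[OF xf] .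
    obtain ps where ps: "\<forall>\<^sub>F n in sequentially. ps n \<in> epi (k n) (X n)" "ps \<longlonglongrightarrow> (u, s)"
      using PK us by (rule PK_convergesD1)
    have ev: "\<forall>\<^sub>F n in sequentially. aff (X n) (fst (ps n)) * aff b u0 \<le> snd (ps n) * aff (X n) u0"
      using ps(1)
    proof eventually_elim
      case (elim n)
      then have el: "fst (ps n) \<in> K" "k n * aff (X n) (fst (ps n)) \<le> snd (ps n)" by (auto simp: epi_def case_prod_unfold)
      have "aff (X n) (fst (ps n)) * aff b u0 \<le> aff (X n) (fst (ps n)) * (k n * aff (X n) u0)"
        using funk_upper[OF XD u0(1), of b n] aff_pos[OF XD el(1), of n] by (intro mult_left_mono) (auto simp: k_def)
      also have "\<dots> = (k n * aff (X n) (fst (ps n))) * aff (X n) u0" by simp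
      also have "\<dots> \<le> snd (ps n) * aff (X n) u0" using el(2) aff_pos[OF XD u0(1), of n] by (intro mult_right_mono) auto
      finally show ?case .
    qed
    have "(\<lambda>n. aff (X n) (fst (ps n)) * aff b u0) \<longlonglongrightarrow> aff x (fst (u, s)) * aff b u0" by (intro tendsto_intros ps(2) Xx)
    moreover have "(\<lambda>n. snd (ps n) * aff (X n) u0) \<longlonglongrightarrow> snd (u, s) * aff x u0" by (intro tendsto_intros ps(2) Xx)
    ultimately have "aff x u * aff b u0 \<le> s * aff x u0" using tendsto_le[OF trivial_limit_sequentially _ _ ev] by fastforce
    then have "aff x u \<le> 0" using u0(2) aff_pos[OF b u0(1)] by (simp add: mult_le_0_iff)
    moreover have "0 \<le> aff x u" using x in_closure_iff weightsD(3)[OF W us] by blast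
    ultimately show ?thesis by simp
  qed
  have "g y = funk_horo b x S y" if y: "y \<in> D" for y
  proof -
    have gl: "ln (l z) = g z - ln (funk x z) + ln (funk x b)" for z by (simp add: l_def)
    have "g b = 0" using LIMSEQ_unique[OF Xg[OF b]] by (simp add: LIMSEQ_const_iff)
    then show ?thesis using gl[of y] gl[of b] l_eq[OF y] l_eq[OF b] by (simp add: funk_horo_def)
  qed
  moreover have "\<forall>p\<in>S. aff x (fst p) = 0" using face by force
  ultimately show ?thesis using XD kpos by (intro that[OF xf _ _ PK clS W]) auto
qed

theorem horofunction_imp_busemann:
  assumes closed_faces: "PK_closed_family {E. E face_of K}" and b: "b \<in> D" and g: "horofunction D b g"
  shows "busemann_point D b g"
proof -
  obtain x X k S c where x: "x \<in> frontier D" and X': "\<forall>n. X n \<in> D" "\<forall>n. 0 < k n"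
    and PK: "PK_converges (\<lambda>n. epi (k n) (X n)) S" and S: "closed S" "weights S c"
    and face': "\<forall>p\<in>S. aff x (fst p) = 0" and g_eq: "\<forall>y\<in>D. g y = funk_horo b x S y"
    by (rule horofunction_limit[OF b g])
  have X: "X n \<in> D" "0 < k n" for n using X' by auto
  have face: "aff x u = 0" if "(u, s) \<in> S" for u s using face' that by force
  have "splits S" by (rule epigraph_limit_splits[OF closed_faces X PK S])
  moreover have "convex S"
    using convex_epi X(2) less_imp_le by (intro PK_limit_convex[OF PK]) blast
  moreover have "(u, s') \<in> S" if us: "(u, s) \<in> S" "s \<le> s'" for u s s'
  proof -
    obtain ps where ps: "\<forall>\<^sub>F n in sequentially. ps n \<in> epi (k n) (X n)" "ps \<longlonglongrightarrow> (u, s)"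
      using PK us(1) by (rule PK_convergesD1)
    then obtain N where N: "\<And>n. n \<ge> N \<Longrightarrow> ps n \<in> epi (k n) (X n)" by (auto simp: eventually_sequentially)
    have "(\<lambda>n. ps (n + N) + (0, s' - s)) \<longlonglongrightarrow> (u, s) + (0, s' - s)"
      by (intro tendsto_intros LIMSEQ_ignore_initial_segment ps(2))
    then have "(\<lambda>n. ps (n + N) + (0, s' - s)) \<longlonglongrightarrow> (u, s')" by simp
    moreover have "ps (n + N) + (0, s' - s) \<in> epi (k (n + N)) (X (n + N))" for n
      using N[of "n + N"] us(2) by (auto simp: epi_def case_prod_unfold plus_prod_def)
    ultimately show ?thesis
      by (intro PK_convergesD2[OF PK, of "\<lambda>n. n + N"]) (auto simp: strict_mono_def)
  qed
  ultimately have "affine_weights S c" using S by (auto simp: affine_weights_def)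
  moreover have "x \<in> closure D" using x by (simp add: frontier_def)
  ultimately obtain p where p: "hconverges D b p (funk_horo b x S)"
    "\<forall>\<delta>>0. \<forall>\<^sub>F n in sequentially. hdist b (p n) + funk_horo b x S (p n) < \<delta>"
    using affine_weights_imp_no_detour[OF b _ _ face'] by blast
  obtain xs where "almost_geodesic D xs" "hconverges D b xs (funk_horo b x S)"
    by (rule almost_geodesic_if_no_detour[OF b p(1)]) (use p(2) in auto)
  then have "hconverges D b xs g" using g_eq by (simp add: hconverges_def)
  with \<open>almost_geodesic D xs\<close> g show ?thesis by (auto simp: busemann_point_def)
qed

section \<open>Constant weights and limits of faces\<close>

lemma weights_Times: "E \<subseteq> K \<Longrightarrow> E \<noteq> {} \<Longrightarrow> weights (E \<times> {1..}) 1"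
  by (auto simp: weights_def)

lemma affine_weights_face:
  assumes E: "E face_of K" "E \<noteq> {}"
  shows "affine_weights (E \<times> {1::real..}) 1"
proof -
  have EK: "E \<subseteq> K" using E(1) by (rule face_of_imp_subset)
  have "splits (E \<times> {1::real..})"
    unfolding splits_def
  proof (intro allI impI)
    fix u s u1 u2 and t :: real
    assume *: "(u, s) \<in> E \<times> {1::real..}" "u1 \<in> K" "u2 \<in> K" "0 < t" "t < 1" "u = (1 - t) *\<^sub>R u1 + t *\<^sub>R u2"
    then have "u1 \<in> E" "u2 \<in> E" using face_of_convex_comb[OF E(1) *(2-5)] by auto
    then show "\<exists>s1 s2. (u1, s1) \<in> E \<times> {1::real..} \<and> (u2, s2) \<in> E \<times> {1::real..} \<and> (1 - t) * s1 + t * s2 \<le> s"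
      using * by (intro exI[of _ 1]) auto
  qed
  moreover have "closed (E \<times> {1::real..})"
    by (intro closed_Times closed_atLeast face_of_imp_closed[OF convex_K closed_K E(1)])
  moreover have "convex (E \<times> {1::real..})"
    by (intro convex_Times face_of_imp_convex[OF E(1)] convex_real_interval)
  ultimately show ?thesis
    using weights_Times[OF EK E(2)] by (auto simp: affine_weights_def)
qed

lemma wsup_Times_upper:
  assumes "E \<subseteq> K" "u \<in> E"
  shows "aff y u \<le> wsup (E \<times> {1..}) y"
  using wsup_upper[OF weights_Times, of E u 1 y] assms by auto

lemma wsup_Times_least:
  assumes E: "E \<subseteq> K" "E \<noteq> {}" and y: "y \<in> D" and le: "\<And>u. u \<in> E \<Longrightarrow> aff y u \<le> m"
  shows "wsup (E \<times> {1..}) y \<le> m"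
proof (rule wsup_least[OF weights_Times[OF E]])
  fix u s assume us: "(u, s) \<in> E \<times> {1::real..}"
  then have "0 < aff y u" "aff y u \<le> m" using aff_pos[OF y] E(1) le by auto
  then have "m * 1 \<le> m * s" using us by (intro mult_left_mono) auto
  with \<open>aff y u \<le> m\<close> show "aff y u \<le> m * s" by simp
qed

text \<open>With constant weight 1, \<open>wsup\<close> at a point of \<open>D\<close> is the
  supremum of \<open>aff y\<close> over the set. Points approximating a given point of
  \<open>C\<close> give the lower bound; maximisers over the \<open>Es n\<close>, which accumulate
  in \<open>C\<close>, give the upper one.\<close>

lemma tendsto_wsup_Times:
  assumes PK: "PK_converges Es C" and Es: "\<And>n. Es n \<subseteq> K" "\<And>n. Es n \<noteq> {}" "\<And>n. closed (Es n)"
    and C: "C \<subseteq> K" "C \<noteq> {}" and y: "y \<in> D"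
  shows "(\<lambda>n. wsup (Es n \<times> {1..}) y) \<longlonglongrightarrow> wsup (C \<times> {1..}) y"
proof (rule order_tendstoI)
  fix a assume a: "a < wsup (C \<times> {1..}) y"
  obtain u where u: "u \<in> C" "a < aff y u"
    using wsup_Times_least[OF C y, of a] a by (meson not_le)
  obtain us where us: "\<forall>\<^sub>F n in sequentially. us n \<in> Es n" "us \<longlonglongrightarrow> u"
    using PK u(1) by (rule PK_convergesD1)
  have "(\<lambda>n. aff y (us n)) \<longlonglongrightarrow> aff y u" by (intro tendsto_intros us)
  then have "\<forall>\<^sub>F n in sequentially. a < aff y (us n)" using u(2) by (rule order_tendstoD)
  with us(1) show "\<forall>\<^sub>F n in sequentially. a < wsup (Es n \<times> {1..}) y"
  proof eventually_elim
    case (elim n)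
    with wsup_Times_upper[OF Es(1) elim(1), of y] show ?case by linarith
  qed
next
  fix a assume a: "wsup (C \<times> {1..}) y < a"
  show "\<forall>\<^sub>F n in sequentially. wsup (Es n \<times> {1..}) y < a"
  proof (rule ccontr)
    assume "\<not> ?thesis"
    then have "\<exists>n\<ge>N. \<not> wsup (Es n \<times> {1..}) y < a" for N by (auto simp: eventually_sequentially)
    then obtain r where r: "strict_mono (r :: nat \<Rightarrow> nat)" "\<And>j. \<not> wsup (Es (r j) \<times> {1..}) y < a"
      using choose_subseq[of "\<lambda>_ n. \<not> wsup (Es n \<times> {1..}) y < a"] by auto
    have "\<exists>u. u \<in> Es (r j) \<and> a \<le> aff y u" for j
    proof -
      have "compact (Es (r j))" using compact_K Es(1,3) compact_Int_closed by (metis inf.absorb_iff2)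
      moreover have "continuous_on (Es (r j)) (aff y)" by (intro continuous_intros)
      ultimately obtain u where u: "u \<in> Es (r j)" "\<forall>v\<in>Es (r j). aff y v \<le> aff y u"
        using continuous_attains_sup[of "Es (r j)" "aff y"] Es(2) by blast
      then have "wsup (Es (r j) \<times> {1..}) y \<le> aff y u" by (intro wsup_Times_least Es y) auto
      then show ?thesis using u(1) r(2)[of j] by force
    qed
    then obtain us where us: "\<And>j. us j \<in> Es (r j)" "\<And>j. a \<le> aff y (us j)" by metis
    have "us j \<in> K" for j using us(1) Es(1) by blast
    then obtain u q where q: "strict_mono (q :: nat \<Rightarrow> nat)" "(us \<circ> q) \<longlonglongrightarrow> u"
      using compact_K unfolding compact_def by meson
    have "u \<in> C"
      by (rule PK_convergesD2[OF PK strict_mono_o[OF r(1) q(1)] _ q(2)]) (use us in auto)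
    have "(\<lambda>j. aff y ((us \<circ> q) j)) \<longlonglongrightarrow> aff y u" by (intro tendsto_intros q(2))
    then have "a \<le> aff y u" by (rule LIMSEQ_le_const) (use us(2) in auto)
    also have "\<dots> \<le> wsup (C \<times> {1..}) y" by (rule wsup_Times_upper[OF C(1) \<open>u \<in> C\<close>])
    finally show False using a by simp
  qed
qed

text \<open>A hyperplane supporting \<open>K\<close> at a relative interior point of
  \<open>E\<close> contains all of \<open>E\<close>. It misses the origin, which is interior to
  \<open>K\<close>, so it can be normalised to the zero set of some \<open>aff z\<close>.\<close>

lemma proper_face_vanishing:
  assumes E: "E face_of K" "E \<noteq> {}" "E \<noteq> K"
  shows "\<exists>z\<in>frontier D. \<forall>u\<in>E. aff z u = 0"
proof -
  have "rel_interior E \<noteq> {}" using rel_interior_eq_empty[OF face_of_imp_convex[OF E(1)]] E(2) by blast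
  then obtain w where w: "w \<in> rel_interior E" by blast
  then have wE: "w \<in> E" using rel_interior_subset by blast
  then have wK: "w \<in> K" using face_of_imp_subset[OF E(1)] by blast
  have int: "interior K \<noteq> {}" using zero_interior_K by blast
  have "w \<notin> rel_interior K"
    using face_of_disjoint_rel_interior[OF E(1,3)] wE by blast
  then obtain a where a: "\<And>y. y \<in> K \<Longrightarrow> inner a w \<le> inner a y" "\<And>y. y \<in> rel_interior K \<Longrightarrow> inner a w < inner a y"
    using supporting_hyperplane_rel_boundary[OF convex_K wK] by metis
  have neg: "inner a w < 0"
    using a(2)[of 0] zero_interior_K interior_subset_rel_interior by force
  define z where "z = (1 / inner a w) *\<^sub>R a"
  have zw: "aff z w = 0" using neg by (simp add: aff_def z_def inner_commute)
  have z_nonneg: "0 \<le> aff z u" if "u \<in> K" for u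
    using a(1)[OF that] neg by (simp add: aff_def z_def inner_commute[of u] divide_simps)
  have "z \<in> frontier D" using in_frontier_iff z_nonneg zw wK by blast
  moreover have "aff z u = 0" if "u \<in> E" for u
  proof -
    have F: "(K \<inter> {y. inner z y = 1}) face_of K"
      by (rule face_of_Int_supporting_hyperplane_le[OF convex_K]) (use z_nonneg in \<open>auto simp: aff_def inner_commute\<close>)
    have "w \<in> (K \<inter> {y. inner z y = 1}) \<inter> rel_interior E"
      using w wK zw by (simp add: aff_def inner_commute)
    then have "(K \<inter> {y. inner z y = 1}) \<inter> rel_interior E \<noteq> {}" by blast
    from subset_of_face_of[OF F face_of_imp_subset[OF E(1)] this] that
    have "inner z u = 1" by blast
    then show ?thesis by (simp add: aff_def inner_commute)
  qed
  ultimately show ?thesis by blast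
qed

text \<open>On the ray from the origin to \<open>x\<close> the function tends to minus infinity,
  since \<open>aff x\<close> vanishes on \<open>C\<close>, whereas a normalised distance function is
  at least \<open>- hdist b q\<close>.\<close>

lemma funk_horo_is_horofunction:
  assumes b: "b \<in> D" and x: "x \<in> frontier D" and C: "C \<subseteq> K" "C \<noteq> {}" and face: "\<And>u. u \<in> C \<Longrightarrow> aff x u = 0"
    and conv: "hconverges D b p (funk_horo b x (C \<times> {1..}))"
  shows "horofunction D b (funk_horo b x (C \<times> {1..}))"
proof -
  let ?S = "C \<times> {1::real..}"
  have False if q: "q \<in> D" and eq: "\<And>y. y \<in> D \<Longrightarrow> funk_horo b x ?S y = hdist y q - hdist b q" for q
  proof -
    define M where "M = - hdist b q + ln (funk x b) + ln (wsup ?S b)"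
    \<comment> \<open>The bound 1/2 ensures \<open>funk x y \<le> 2\<close>; the other makes the sum
      fall short of \<open>- hdist b q\<close> by at least 1.\<close>
    define e where "e = min (1 / 2) (exp (M - ln 2 - 1))"
    have e: "0 < e" "e \<le> 1 / 2" by (auto simp: e_def)
    define y where "y = (1 - e) *\<^sub>R x"
    have x0: "\<forall>u\<in>K. 0 \<le> aff x u" using x in_frontier_iff by blast
    have y: "y \<in> D" unfolding y_def using e by (intro scaleR_in_D x0) auto
    have aff_y: "aff y u = e + (1 - e) * aff x u" for u
      by (simp add: aff_def y_def algebra_simps)
    have "funk x y \<le> 2"
    proof (rule funk_least[OF y])
      fix u assume u: "u \<in> K"
      have "1 * aff x u \<le> (2 * (1 - e)) * aff x u" using e x0 u by (intro mult_right_mono) auto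
      then show "aff x u \<le> 2 * aff y u" using e by (simp add: aff_y algebra_simps)
    qed
    then have 1: "ln (funk x y) \<le> ln 2" using funk_pos[OF y, of x] by simp
    have "wsup ?S y \<le> e" using face by (intro wsup_Times_least C y) (simp add: aff_y)
    then have "ln (wsup ?S y) \<le> ln e" using wsup_pos[OF weights_Times[OF C] y] by simp
    also have "\<dots> \<le> ln (exp (M - ln 2 - 1))" using e by (subst ln_le_cancel_iff) (auto simp: e_def)
    finally have "ln (wsup ?S y) \<le> M - ln 2 - 1" by simp
    with 1 have "funk_horo b x ?S y < - hdist b q" by (simp add: funk_horo_def M_def)
    then show False using eq[OF y] hdist_nonneg[OF y q] by simp
  qed
  then show ?thesis using conv by (auto simp: horofunction_def)
qed

text \<open>
  Along an almost-geodesic, the multiples of \<open>aff (p n)\<close> with supremum 1 over \<open>C\<close> eventually almost dominate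
  \<open>aff y / W y\<close> for every \<open>y\<close>. With \<open>y = 0\<close> at one end of a segment meeting \<open>C\<close> in its interior, this forces
  \<open>aff y \<le> W y\<close> at the other end, which therefore lies in \<open>C\<close>.
\<close>

lemma busemann_imp_face:
  assumes b: "b \<in> D" and C: "C \<subseteq> K" "C \<noteq> {}" "closed C" "convex C"
    and bus: "busemann_point D b (funk_horo b x (C \<times> {1..}))"
  shows "C face_of K"
proof -
  let ?S = "C \<times> {1::real..}"
  define W where "W = wsup ?S"
  define G where "G = funk_horo b x ?S"
  have weights: "weights ?S 1" using weights_Times C by blast
  obtain p where geo: "almost_geodesic D p" and conv: "hconverges D b p G"
    using bus by (auto simp: busemann_point_def G_def)
  have p: "p n \<in> D" for n using conv by (simp add: hconverges_def)
  have Wpos: "0 < W y" if "y \<in> D" for y unfolding W_def using that by (rule wsup_pos[OF weights])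
  \<comment> \<open>The detour cost and the convergence at \<open>y\<close> are added; the factors
    involving \<open>x\<close> drop out by the triangle inequality for \<open>funk\<close> from
    \<open>x\<close> through \<open>p n\<close> to \<open>y\<close>.\<close>
  have tight: "\<forall>\<^sub>F n in sequentially. funk y (p n) * W (p n) \<le> W y * exp \<delta>" if y: "y \<in> D" and \<delta>: "0 < \<delta>" for y \<delta>
  proof -
    have "(\<lambda>n. hdist y (p n) - hdist b (p n)) \<longlonglongrightarrow> G y" using conv y by (simp add: hconverges_def)
    then have "\<forall>\<^sub>F n in sequentially. hdist y (p n) - hdist b (p n) < G y + \<delta> / 2"
      by (rule order_tendstoD) (use \<delta> in simp)
    moreover have "\<forall>\<^sub>F n in sequentially. hdist b (p n) + G (p n) < \<delta> / 2"
      by (rule no_detour_if_almost_geodesic[OF b geo conv]) (use \<delta> in simp)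
    ultimately show ?thesis
    proof eventually_elim
      case (elim n)
      have "ln (funk x y) \<le> ln (funk x (p n) * funk (p n) y)"
        using funk_triangle[OF p y, of x n] funk_pos[OF y, of x] by simp
      also have "\<dots> = ln (funk x (p n)) + ln (funk (p n) y)"
        using funk_pos[OF p, of x n] funk_pos[OF y, of "p n"] by (simp add: ln_mult)
      finally have "ln (funk y (p n)) + ln (W (p n)) \<le> ln (W y) + \<delta>"
        using elim hilbert_dist_eq[OF y p, of n] by (simp add: G_def funk_horo_def W_def)
      then have "exp (ln (funk y (p n)) + ln (W (p n))) \<le> exp (ln (W y) + \<delta>)" by simp
      then show ?case
        using funk_pos[OF p, of y n] Wpos[OF p, of n] Wpos[OF y] by (simp add: exp_add)
    qed
  qed
  have W0: "W 0 \<le> 1" unfolding W_def by (rule wsup_Times_least[OF C(1,2) zero_D]) simp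
  have in_C: "a \<in> C" if a: "a \<in> K" "a' \<in> K" and t: "0 < t" "t < 1" and u: "(1 - t) *\<^sub>R a + t *\<^sub>R a' \<in> C" for a a' and t :: real
  proof -
    have le: "aff y a \<le> W y" if y: "y \<in> D" for y
    proof -
      \<comment> \<open>The estimate for \<open>y\<close> is used at \<open>a\<close> and the one
        for the origin at \<open>a'\<close>. Weighted by \<open>1 - t\<close> and \<open>t\<close>
        they combine, because the convex combination of the values of \<open>aff (p n)\<close> is
        its value at a point of \<open>C\<close> and so at most \<open>W (p n)\<close>.\<close>
      have approx: "(1 - t) * aff y a + t * W y \<le> W y * exp \<delta>" if \<delta>: "0 < \<delta>" for \<delta>
      proof -
        obtain n where n: "funk y (p n) * W (p n) \<le> W y * exp \<delta>" "funk 0 (p n) * W (p n) \<le> W 0 * exp \<delta>"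
          using eventually_happens[OF eventually_conj[OF tight[OF y \<delta>] tight[OF zero_D \<delta>]]] by auto
        define A B V where "A = aff (p n) a" and "B = aff (p n) a'" and "V = W (p n)"
        have AB: "0 < A" "0 < B" "0 < V" using aff_pos[OF p] a Wpos[OF p] by (auto simp: A_def B_def V_def)
        have V: "(1 - t) * A + t * B \<le> V"
          using wsup_Times_upper[OF C(1) u, of "p n"] by (simp add: A_def B_def V_def W_def aff_convex_comb)
        have "aff y a * V \<le> funk y (p n) * A * V"
          using funk_upper[OF p a(1), of y n] AB by (intro mult_right_mono) (auto simp: A_def)
        also have "\<dots> = (funk y (p n) * V) * A" by simp
        also have "\<dots> \<le> (W y * exp \<delta>) * A" using n(1) AB by (intro mult_right_mono) (auto simp: V_def)
        finally have 1: "aff y a * V \<le> W y * exp \<delta> * A" .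
        have "1 * V \<le> funk 0 (p n) * B * V"
          using funk_upper[OF p a(2), of 0 n] AB by (intro mult_right_mono) (auto simp: B_def)
        also have "\<dots> = (funk 0 (p n) * V) * B" by simp
        also have "\<dots> \<le> (1 * exp \<delta>) * B"
          using n(2) AB W0 by (intro mult_right_mono order_trans[OF n(2)[folded V_def]]) auto
        finally have "W y * V \<le> W y * (exp \<delta> * B)" using Wpos[OF y] by simp
        then have "t * (W y * V) \<le> t * (W y * (exp \<delta> * B))" using t by simp
        moreover have "(1 - t) * (aff y a * V) \<le> (1 - t) * (W y * exp \<delta> * A)" using 1 t by simp
        ultimately have "((1 - t) * aff y a + t * W y) * V \<le> W y * exp \<delta> * ((1 - t) * A + t * B)"
          by (simp add: algebra_simps)
        also have "\<dots> \<le> W y * exp \<delta> * V" using V Wpos[OF y] by (intro mult_left_mono) auto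
        finally show ?thesis using AB by simp
      qed
      have "(\<lambda>n. W y * exp (1 / real (Suc n))) \<longlonglongrightarrow> W y * exp 0"
        using LIMSEQ_Suc[OF lim_1_over_n] by (intro tendsto_intros) simp
      then have "(1 - t) * aff y a + t * W y \<le> W y * exp 0"
        by (rule LIMSEQ_le_const) (use approx in simp)
      then have "(1 - t) * aff y a \<le> (1 - t) * W y" by (simp add: algebra_simps)
      then show ?thesis using t by simp
    qed
    show "a \<in> C"
    proof (rule ccontr)
      \<comment> \<open>A functional strictly separating \<open>a\<close> from \<open>C\<close>,
        scaled down into \<open>D\<close>, is a \<open>y\<close> with
        \<open>W y < aff y a\<close>.\<close>
      assume "a \<notin> C"
      then obtain v \<beta> where v: "inner v a < \<beta>" "\<forall>c\<in>C. \<beta> < inner v c"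
        using separating_hyperplane_closed_point[OF C(4,3)] by blast
      obtain e where e: "e > 0" "cball 0 e \<subseteq> D" using open_D zero_D open_contains_cball by blast
      define d where "d = e / (norm v + 1)"
      have nv: "0 < norm v + 1" by (simp add: add_nonneg_pos)
      have d: "0 < d" using e nv by (simp add: d_def)
      have "d * norm v \<le> e" using e nv by (simp add: d_def field_simps)
      then have y: "d *\<^sub>R v \<in> D" using e d by auto
      have "W (d *\<^sub>R v) \<le> 1 - d * \<beta>"
        unfolding W_def
      proof (rule wsup_Times_least[OF C(1,2) y])
        fix c assume "c \<in> C"
        then have "\<beta> \<le> inner v c" using v(2) by (simp add: less_imp_le)
        then have "d * \<beta> \<le> d * inner v c" using d by simp
        then show "aff (d *\<^sub>R v) c \<le> 1 - d * \<beta>" by (simp add: aff_def inner_commute)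
      qed
      moreover have "d * inner v a < d * \<beta>" using v d by simp
      then have "1 - d * \<beta> < aff (d *\<^sub>R v) a" by (simp add: aff_def inner_commute)
      ultimately show False using le[OF y] by simp
    qed
  qed
  show ?thesis
    unfolding face_of_def
  proof (intro conjI ballI impI)
    show "C \<subseteq> K" "convex C" by fact+
    fix a a' u assume a: "a \<in> K" "a' \<in> K" and u: "u \<in> C" "u \<in> open_segment a a'"
    then obtain t where t: "0 < t" "t < 1" "u = (1 - t) *\<^sub>R a + t *\<^sub>R a'" by (auto simp: in_segment)
    show "a \<in> C" using in_C[OF a t(1,2)] u(1) t(3) by simp
    have "u = (1 - (1 - t)) *\<^sub>R a' + (1 - t) *\<^sub>R a" using t(3) by simp
    then show "a' \<in> C" using in_C[OF a(2,1), of "1 - t"] u(1) t(1,2) by simp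
  qed
qed

theorem closed_faces_if_all_busemann:
  assumes b: "b \<in> D" and bus: "\<And>g. horofunction D b g \<Longrightarrow> busemann_point D b g"
  shows "PK_closed_family {E. E face_of K}"
  unfolding PK_closed_family_def
proof (intro allI impI)
  fix Cs C assume Cs': "\<forall>n. Cs n \<in> {E. E face_of K}" and C: "closed C" and PK: "PK_converges Cs C"
  have Cs: "Cs n face_of K" for n using Cs' by blast
  have CsK: "Cs n \<subseteq> K" for n using Cs face_of_imp_subset by blast
  have CK: "C \<subseteq> K" by (rule PK_limit_subset[OF PK CsK closed_K])
  have convC: "convex C" using Cs face_of_imp_convex by (intro PK_limit_convex[OF PK]) blast
  have "C face_of K"
  \<comment> \<open>These cases are set apart since no \<open>aff z\<close> vanishes on all of
    \<open>K\<close>, where it is 1 at the origin, and since weights have to be nonempty.\<close>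
  proof (cases "C = {} \<or> (\<forall>N. \<exists>n\<ge>N. Cs n = K)")
    case True
    then show ?thesis
    proof
      assume "\<forall>N. \<exists>n\<ge>N. Cs n = K"
      then have "\<exists>n\<ge>N. Cs n = K" for N by blast
      then obtain r where r: "strict_mono (r :: nat \<Rightarrow> nat)" "\<And>j. Cs (r j) = K"
        using choose_subseq[of "\<lambda>_ n. Cs n = K"] by auto
      have "K \<subseteq> C"
        using PK_convergesD2[OF PK r(1)] r(2) by (metis subsetI tendsto_const)
      with CK have "C = K" by blast
      then show ?thesis using face_of_refl[OF convex_K] by simp
    qed simp
  next
    case False
    then have C_ne: "C \<noteq> {}" and "\<exists>N. \<forall>n\<ge>N. Cs n \<noteq> K" by auto
    then have ev1: "\<forall>\<^sub>F n in sequentially. Cs n \<noteq> K" by (simp add: eventually_sequentially)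
    obtain c where "c \<in> C" using C_ne by blast
    then obtain cs where "\<forall>\<^sub>F n in sequentially. cs n \<in> Cs n" using PK_convergesD1[OF PK] by metis
    with ev1 have "\<forall>\<^sub>F n in sequentially. Cs n \<noteq> K \<and> Cs n \<noteq> {}" by eventually_elim auto
    then obtain N where N: "\<And>n. n \<ge> N \<Longrightarrow> Cs n \<noteq> K \<and> Cs n \<noteq> {}" by (auto simp: eventually_sequentially)
    have "\<exists>z\<in>frontier D. \<forall>u\<in>Cs (n + N). aff z u = 0" for n
      using N[of "n + N"] by (intro proper_face_vanishing Cs) auto
    then obtain z where z: "\<And>n. z n \<in> frontier D" "\<And>n u. u \<in> Cs (n + N) \<Longrightarrow> aff (z n) u = 0" by metis
    have "compact (frontier D)" by (rule compact_frontier_bounded[OF bounded_D])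
    \<comment> \<open>Each face has its own boundary point; a limit of these points works for
      \<open>C\<close>, as the equation \<open>aff z u = 0\<close> passes to the limit in both
      arguments.\<close>
    then obtain x r where x: "x \<in> frontier D" and r: "strict_mono (r :: nat \<Rightarrow> nat)" "(z \<circ> r) \<longlonglongrightarrow> x"
      using z(1) unfolding compact_def by meson
    define Es where "Es n = Cs (r n + N)" for n
    have rN: "strict_mono (\<lambda>n. r n + N)" using r(1) by (simp add: strict_mono_def)
    have PKE: "PK_converges Es C" using PK_converges_subseq[OF PK rN] by (simp add: Es_def[abs_def] o_def)
    have Es: "Es n face_of K" "Es n \<noteq> {}" "Es n \<subseteq> K" "closed (Es n)" for n
      using Cs N CsK face_of_imp_closed[OF convex_K closed_K Cs] by (auto simp: Es_def)
    have zE: "aff ((z \<circ> r) n) u = 0" if "u \<in> Es n" for u n using z(2) that by (simp add: Es_def)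
    have face: "aff x u = 0" if u: "u \<in> C" for u
    proof -
      obtain us where us: "\<forall>\<^sub>F n in sequentially. us n \<in> Es n" "us \<longlonglongrightarrow> u"
        using PKE u by (rule PK_convergesD1)
      have "\<forall>\<^sub>F n in sequentially. aff ((z \<circ> r) n) (us n) = 0"
        using us(1) by eventually_elim (rule zE)
      then have "(\<lambda>n. aff ((z \<circ> r) n) (us n)) \<longlonglongrightarrow> 0" by (rule tendsto_eventually)
      moreover have "(\<lambda>n. aff ((z \<circ> r) n) (us n)) \<longlonglongrightarrow> aff x u" by (intro tendsto_intros us r)
      ultimately show ?thesis using LIMSEQ_unique by blast
    qed
    obtain Ys where Ys': "\<forall>n. compact (Ys n) \<and> b \<in> Ys n \<and> Ys n \<subseteq> D"
      "\<forall>y\<in>D. \<forall>\<^sub>F n in sequentially. y \<in> Ys n"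
      by (rule exhaustion[OF b])
    have Ys: "compact (Ys n)" "Ys n \<noteq> {}" "Ys n \<subseteq> D" "y \<in> D \<Longrightarrow> \<forall>\<^sub>F n in sequentially. y \<in> Ys n" for n y
      using Ys' by blast+
    define \<epsilon> :: "nat \<Rightarrow> real" where "\<epsilon> n = 1 / Suc n" for n
    have \<epsilon>: "0 < \<epsilon> n" for n by (simp add: \<epsilon>_def)
    have \<epsilon>0: "\<epsilon> \<longlonglongrightarrow> 0" using LIMSEQ_Suc[OF lim_1_over_n] by (simp add: \<epsilon>_def[abs_def])
    have "\<exists>p \<kappa>. approximates ((z \<circ> r) n) (Es n \<times> {1..}) (Ys n) (\<epsilon> n) p \<kappa>" for n
    proof (rule ex_approximates[OF affine_weights_face[OF Es(1,2)] _ _ Ys(1-3) \<epsilon>])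
      show "(z \<circ> r) n \<in> closure D" using z(1) by (simp add: frontier_def)
      show "aff ((z \<circ> r) n) u = 0" if "(u, s) \<in> Es n \<times> {1::real..}" for u s using zE that by blast
    qed
    then obtain p \<kappa> where ap: "\<And>n. approximates ((z \<circ> r) n) (Es n \<times> {1..}) (Ys n) (\<epsilon> n) (p n) (\<kappa> n)" by metis
    have "hconverges D b p (funk_horo b x (C \<times> {1..}))"
      by (rule approximates_hconverges(1)[OF b \<epsilon> \<epsilon>0 r(2) ap Ys(4) weights_Times[OF Es(3,2)]
            tendsto_wsup_Times[OF PKE Es(3,2,4) CK C_ne] weights_Times[OF CK C_ne]])
    then have "busemann_point D b (funk_horo b x (C \<times> {1..}))"
      by (intro bus funk_horo_is_horofunction[OF b x CK C_ne face])
    then show ?thesis by (rule busemann_imp_face[OF b CK C_ne C convC])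
  qed
  then show "C \<in> {E. E face_of K}" by simp
qed

end

theorem theorem1p2:
  fixes D :: "'a::euclidean_space set" and b :: 'a
  assumes "bounded D" and "convex D" and "open D" and "0 \<in> D" and "b \<in> D"
  shows "(\<forall>g. horofunction D b g \<longrightarrow> busemann_point D b g) \<longleftrightarrow>
         PK_closed_family {E. E face_of polar D}"
proof -
  interpret hilbert_domain D using assms by unfold_locales
  show ?thesis
    using closed_faces_if_all_busemann[OF assms(5)] horofunction_imp_busemann[OF _ assms(5)] by blast
qed

end
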